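(* Let $G$ be a map on an orientable surface, $D_0$ a Schnyder orientation of its primal-dual completion $\hat G$, and $f_0$ a face of $\hat G$. Let $S(\hat G,D_0)$ be the set of all Schnyder orientations of $\hat G$ that have the same outdegrees and the same type as $D_0$. Then $(S(\hat G,D_0),\leq_{f_0})$ is a distributive lattice.
   Context: Maps: graphs embedded on an orientable surface of genus $g$ with all faces open disks, without contractible cycles of length 1 or 2. Angle labeling: $\ell$ from angles (face corners) of $G$ to $\mathbb{Z}_3$; an edge is type 0 if its four incident angles have equal labels, type 1 or 2 if in clockwise order they read $i-1,i,i,i+1$; EDGE: every edge has type 0, 1 or 2. Primal-dual completion $\hat G$: $G$ and $G^*$ embedded together, each edge crossing its dual once at a new edge-vertex; faces of $\hat G$ correspond to angles of $G$; each edge of $\hat G$ joins an edge-vertex to a primal- or dual-vertex. A Schnyder orientation of $\hat G$ is one for which there is an EDGE angle labeling of $G$ such that every edge of $\hat G$ separating faces (angles) $a,a'$ is oriented away from its edge-vertex iff $\ell(a)=\ell(a')$. For a cycle $C$ of $G$ with a direction, with subdivision $\hat C$ in $\hat G$, $\gamma(C)$ = (edges of $\hat G$ not on $\hat C$ oriented away from $\hat C$ on its right) $-$ (those on its left). Fix a set $\{B_1,\ldots,B_{2g}\}$ of cycles of $G$ forming a basis for the homology; the type of an orientation is $(\gamma(B_1),\ldots,\gamma(B_{2g}))$. Order: fix a reference orientation of the edges of $\hat G$ and characteristic flows in $\mathbb{Z}^{E}$ of walks and oriented subgraphs. Let $\mathcal{F}'$ be the set of counterclockwise facial walks of $\hat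 G$ other than the one of $f_0$. A $0$-homologous oriented subgraph $T$ is counterclockwise if $\phi(T)=\sum_{F\in\mathcal{F}'}\lambda_F\phi(F)$ with all $\lambda_F\in\mathbb{N}$. For orientations $D,D'$, $D\setminus D'$ is the oriented subgraph of $D$ of edges oriented differently in $D'$, and $D\leq_{f_0} D'$ iff $D\setminus D'$ is counterclockwise. *)

theory Defs
  imports
    "HOL-Combinatorics.Orbits"
    "HOL-Library.Numeral_Type"
    "HOL-Algebra.Lattice"
begin

section \<open>Maps on orientable surfaces\<close>

text \<open>
  A graph cellularly embedded on a closed orientable surface is represented by its rotation
  system. The elements of the finite type \<^typ>\<open>'a\<close> are the darts (edges with a direction);
  \<open>opp\<close> reverses a dart, and \<open>rot d\<close> is the dart following \<open>d\<close> in counterclockwise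
  order around the initial vertex of \<open>d\<close>. An angle is named by the dart \<open>d\<close> such that the
  angle lies between \<open>d\<close> and \<open>rot d\<close>; it is the corner to the left of \<open>d\<close> at its initial vertex.
\<close>

record 'a cmap =
  rot :: "'a \<Rightarrow> 'a"
  opp :: "'a \<Rightarrow> 'a"

text \<open>The successor of a dart on the boundary of the face to its left, so that facial walks
  have their face on the left, i.e. are counterclockwise.\<close>

definition face_next :: "'a cmap \<Rightarrow> 'a \<Rightarrow> 'a" where
  "face_next M d = inv (rot M) (opp M d)"

text \<open>A vertex is the set of its outgoing darts, an edge the set of its two darts, and a face
  the set of darts having it on their left.\<close>

definition vertices :: "'a cmap \<Rightarrow> 'a set set" where
  "vertices M = range (orbit (rot M))"

definition edges :: "'a cmap \<Rightarrow> 'a set set" where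
  "edges M = range (\<lambda>d. {d, opp M d})"

definition faces :: "'a cmap \<Rightarrow> 'a set set" where
  "faces M = range (orbit (face_next M))"

definition connected_cmap :: "'a cmap \<Rightarrow> bool" where
  "connected_cmap M \<longleftrightarrow>
     (\<forall>d d'. (d, d') \<in> ({(x, rot M x) | x. True} \<union> {(x, opp M x) | x. True})\<^sup>*)"

definition combinatorial_map :: "'a::finite cmap \<Rightarrow> bool" where
  "combinatorial_map M \<longleftrightarrow>
     bij (rot M) \<and>
     (\<forall>d. opp M (opp M d) = d) \<and> (\<forall>d. opp M d \<noteq> d) \<and> connected_cmap M"

definition has_genus :: "'a cmap \<Rightarrow> nat \<Rightarrow> bool" where
  "has_genus M g \<longleftrightarrow>
     int (card (vertices M)) - int (card (edges M)) + int (card (faces M)) = 2 - 2 * int g"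


section \<open>Walks, cycles and contractibility\<close>

definition tail :: "'a cmap \<Rightarrow> 'a \<Rightarrow> 'a set" where
  "tail M d = orbit (rot M) d"

definition head :: "'a cmap \<Rightarrow> 'a \<Rightarrow> 'a set" where
  "head M d = tail M (opp M d)"

definition walk :: "'a cmap \<Rightarrow> 'a list \<Rightarrow> bool" where
  "walk M w \<longleftrightarrow> successively (\<lambda>d d'. head M d = tail M d') w"

definition closed_walk :: "'a cmap \<Rightarrow> 'a list \<Rightarrow> bool" where
  "closed_walk M w \<longleftrightarrow> w \<noteq> [] \<and> walk M w \<and> head M (last w) = tail M (hd w)"

text \<open>A cycle with a direction: no vertex is repeated and no edge is used twice (the latter only
  matters for length 2, where it excludes going back along the same edge).\<close>

definition cycle :: "'a cmap \<Rightarrow> 'a list \<Rightarrow> bool" where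
  "cycle M c \<longleftrightarrow>
     closed_walk M c \<and> distinct (map (tail M) c) \<and> set c \<inter> opp M ` set c = {}"

definition facial_walk :: "'a cmap \<Rightarrow> 'a \<Rightarrow> 'a list" where
  "facial_walk M d = map (\<lambda>i. (face_next M ^^ i) d) [0..<card (orbit (face_next M) d)]"

text \<open>Since all faces are open disks, homotopy of walks on the surface is generated by removing
  and inserting spurs and boundary walks of faces.\<close>

inductive homotopic :: "'a cmap \<Rightarrow> 'a list \<Rightarrow> 'a list \<Rightarrow> bool" for M where
  refl: "walk M w \<Longrightarrow> homotopic M w w"
| sym: "homotopic M v w \<Longrightarrow> homotopic M w v"
| trans: "homotopic M u v \<Longrightarrow> homotopic M v w \<Longrightarrow> homotopic M u w"
| spur: "walk M (u @ v) \<Longrightarrow> walk M (u @ [d, opp M d] @ v) \<Longrightarrow>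
    homotopic M (u @ [d, opp M d] @ v) (u @ v)"
| face: "walk M (u @ v) \<Longrightarrow> walk M (u @ facial_walk M d @ v) \<Longrightarrow>
    homotopic M (u @ facial_walk M d @ v) (u @ v)"

definition contractible :: "'a cmap \<Rightarrow> 'a list \<Rightarrow> bool" where
  "contractible M w \<longleftrightarrow> homotopic M w []"

definition surface_map :: "'a::finite cmap \<Rightarrow> nat \<Rightarrow> bool" where
  "surface_map M g \<longleftrightarrow>
     combinatorial_map M \<and> has_genus M g \<and>
     (\<forall>c. cycle M c \<and> length c \<in> {1, 2} \<longrightarrow> \<not> contractible M c)"


section \<open>Orientations, flows and homology\<close>

text \<open>An orientation is the set of darts along which the edges are directed. An oriented
  subgraph is likewise a set of darts.\<close>

definition orientation :: "'a cmap \<Rightarrow> 'a set \<Rightarrow> bool" where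
  "orientation M D \<longleftrightarrow> (\<forall>d. d \<in> D \<longleftrightarrow> opp M d \<notin> D)"

definition outdegree :: "'a set \<Rightarrow> 'a set \<Rightarrow> nat" where
  "outdegree D v = card (D \<inter> v)"

text \<open>\<open>R\<close> is the reference orientation. Edges are identified with the darts in \<open>R\<close>; flows vanish
  outside \<open>R\<close>.\<close>

definition walk_flow :: "'a cmap \<Rightarrow> 'a set \<Rightarrow> 'a list \<Rightarrow> 'a \<Rightarrow> int" where
  "walk_flow M R w d =
     (if d \<in> R then int (count_list w d) - int (count_list w (opp M d)) else 0)"

text \<open>Applied to a face, the next function gives the characteristic flow of its counterclockwise
  facial walk, which traverses every dart of the face exactly once.\<close>

definition subgraph_flow :: "'a cmap \<Rightarrow> 'a set \<Rightarrow> 'a set \<Rightarrow> 'a \<Rightarrow> int" where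
  "subgraph_flow M R T d =
     (if d \<in> R then of_bool (d \<in> T) - of_bool (opp M d \<in> T) else 0)"

definition zero_homologous :: "'a cmap \<Rightarrow> 'a set \<Rightarrow> ('a \<Rightarrow> int) \<Rightarrow> bool" where
  "zero_homologous M R f \<longleftrightarrow>
     (\<exists>c :: 'a set \<Rightarrow> int. \<forall>d. f d = (\<Sum>F\<in>faces M. c F * subgraph_flow M R F d))"

text \<open>The classes of the \<open>2 g\<close> cycles form a basis of the first homology group, i.e. of the group
  of flows generated by closed walks modulo the group generated by facial walks.\<close>

definition homology_basis :: "'a cmap \<Rightarrow> 'a set \<Rightarrow> nat \<Rightarrow> 'a list list \<Rightarrow> bool" where
  "homology_basis M R g B \<longleftrightarrow>
     length B = 2 * g \<and> (\<forall>c\<in>set B. cycle M c) \<and>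
     (\<forall>w. closed_walk M w \<longrightarrow>
        (\<exists>m :: nat \<Rightarrow> int. zero_homologous M R
           (\<lambda>d. walk_flow M R w d - (\<Sum>i<2 * g. m i * walk_flow M R (B ! i) d)))) \<and>
     (\<forall>m :: nat \<Rightarrow> int.
        zero_homologous M R (\<lambda>d. \<Sum>i<2 * g. m i * walk_flow M R (B ! i) d) \<longrightarrow>
        (\<forall>i<2 * g. m i = 0))"

definition counterclockwise :: "'a cmap \<Rightarrow> 'a set \<Rightarrow> 'a set \<Rightarrow> 'a set \<Rightarrow> bool" where
  "counterclockwise M R f0 T \<longleftrightarrow>
     zero_homologous M R (subgraph_flow M R T) \<and>
     (\<exists>c :: 'a set \<Rightarrow> nat. \<forall>d.
        subgraph_flow M R T d = (\<Sum>F\<in>faces M - {f0}. int (c F) * subgraph_flow M R F d))"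

definition orientation_le :: "'a cmap \<Rightarrow> 'a set \<Rightarrow> 'a set \<Rightarrow> 'a set \<Rightarrow> 'a set \<Rightarrow> bool" where
  "orientation_le M R f0 D D' \<longleftrightarrow> counterclockwise M R f0 (D - D')"


section \<open>The primal-dual completion\<close>

text \<open>
  For a dart \<open>d\<close> of the map, the completion has an edge joining the initial vertex of \<open>d\<close> to the
  edge-vertex of \<open>d\<close>, with darts \<open>PV d\<close> (leaving the primal vertex) and \<open>PE d\<close> (leaving the
  edge-vertex), and an edge joining the dual vertex of the face to the left of \<open>d\<close> to the
  edge-vertex of \<open>d\<close>, with darts \<open>DV d\<close> (leaving the dual vertex) and \<open>DE d\<close> (leaving the
  edge-vertex). Counterclockwise around the edge-vertex of \<open>d\<close> one meets
  \<open>PE d\<close>, \<open>DE (opp d)\<close>, \<open>PE (opp d)\<close>, \<open>DE d\<close>.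
\<close>

datatype 'a hat_dart = PV 'a | PE 'a | DV 'a | DE 'a

fun hat_rot :: "'a cmap \<Rightarrow> 'a hat_dart \<Rightarrow> 'a hat_dart" where
  "hat_rot M (PV d) = PV (rot M d)"
| "hat_rot M (DV d) = DV (face_next M d)"
| "hat_rot M (PE d) = DE (opp M d)"
| "hat_rot M (DE d) = PE d"

fun hat_opp :: "'a hat_dart \<Rightarrow> 'a hat_dart" where
  "hat_opp (PV d) = PE d"
| "hat_opp (PE d) = PV d"
| "hat_opp (DV d) = DE d"
| "hat_opp (DE d) = DV d"

definition completion :: "'a cmap \<Rightarrow> 'a hat_dart cmap" where
  "completion M = \<lparr>rot = hat_rot M, opp = hat_opp\<rparr>"

definition angle_face :: "'a cmap \<Rightarrow> 'a \<Rightarrow> 'a hat_dart set" where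
  "angle_face M a = orbit (face_next (completion M)) (PV a)"

definition subdivision :: "'a cmap \<Rightarrow> 'a list \<Rightarrow> 'a hat_dart list" where
  "subdivision M c = concat (map (\<lambda>d. [PV d, PE (opp M d)]) c)"


section \<open>Schnyder orientations\<close>

text \<open>The four angles incident to the edge of \<open>d\<close>, in clockwise order.\<close>

definition edge_angles :: "'a cmap \<Rightarrow> 'a \<Rightarrow> 'a list" where
  "edge_angles M d = [d, inv (rot M) (opp M d), opp M d, inv (rot M) d]"

definition edge_type_0 :: "'a cmap \<Rightarrow> ('a \<Rightarrow> 3) \<Rightarrow> 'a \<Rightarrow> bool" where
  "edge_type_0 M l d \<longleftrightarrow> (\<exists>i. map l (edge_angles M d) = [i, i, i, i])"

definition edge_type_1_or_2 :: "'a cmap \<Rightarrow> ('a \<Rightarrow> 3) \<Rightarrow> 'a \<Rightarrow> bool" where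
  "edge_type_1_or_2 M l d \<longleftrightarrow>
     (\<exists>k i. map l (rotate k (edge_angles M d)) = [i - 1, i, i, i + 1])"

definition EDGE :: "'a cmap \<Rightarrow> ('a \<Rightarrow> 3) \<Rightarrow> bool" where
  "EDGE M l \<longleftrightarrow> (\<forall>d. edge_type_0 M l d \<or> edge_type_1_or_2 M l d)"

definition schnyder_orientation :: "'a cmap \<Rightarrow> 'a hat_dart set \<Rightarrow> bool" where
  "schnyder_orientation M D \<longleftrightarrow>
     orientation (completion M) D \<and>
     (\<exists>l. EDGE M l \<and>
        (\<forall>x \<in> range PE \<union> range DE. \<forall>a a'.
           x \<in> angle_face M a \<and> opp (completion M) x \<in> angle_face M a' \<longrightarrow>
           (x \<in> D \<longleftrightarrow> l a = l a')))"

text \<open>The darts met strictly between \<open>a\<close> and \<open>b\<close> when turning counterclockwise from \<open>a\<close> to \<open>b\<close>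
  around their common initial vertex.\<close>

definition darts_between :: "'a cmap \<Rightarrow> 'a \<Rightarrow> 'a \<Rightarrow> 'a set" where
  "darts_between M a b =
     {(rot M ^^ k) a | k. 0 < k \<and> (\<forall>j. 0 < j \<and> j \<le> k \<longrightarrow> (rot M ^^ j) a \<noteq> b)}"

text \<open>The darts off a directed cycle \<open>c\<close> that leave a vertex of \<open>c\<close> on its left resp. right.\<close>

definition left_darts :: "'a cmap \<Rightarrow> 'a list \<Rightarrow> 'a set" where
  "left_darts M c =
     (\<Union>i<length c. darts_between M (c ! (Suc i mod length c)) (opp M (c ! i)))"

definition right_darts :: "'a cmap \<Rightarrow> 'a list \<Rightarrow> 'a set" where
  "right_darts M c =
     (\<Union>i<length c. darts_between M (opp M (c ! i)) (c ! (Suc i mod length c)))"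

definition gamma :: "'a cmap \<Rightarrow> 'a hat_dart set \<Rightarrow> 'a list \<Rightarrow> int" where
  "gamma M D c =
     int (card (D \<inter> right_darts (completion M) (subdivision M c))) -
     int (card (D \<inter> left_darts (completion M) (subdivision M c)))"

definition orientation_type :: "'a cmap \<Rightarrow> 'a list list \<Rightarrow> 'a hat_dart set \<Rightarrow> int list" where
  "orientation_type M B D = map (gamma M D) B"

definition schnyder_class ::
  "'a cmap \<Rightarrow> 'a list list \<Rightarrow> 'a hat_dart set \<Rightarrow> 'a hat_dart set set" where
  "schnyder_class M B D0 =
     {D. schnyder_orientation M D \<and>
         (\<forall>v\<in>vertices (completion M). outdegree D v = outdegree D0 v) \<and>
         orientation_type M B D = orientation_type M B D0}"


section \<open>Distributive lattices\<close>

definition distributive_lattice :: "('a, 'b) gorder_scheme \<Rightarrow> bool" where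
  "distributive_lattice L \<longleftrightarrow>
     lattice L \<and>
     (\<forall>x\<in>carrier L. \<forall>y\<in>carrier L. \<forall>z\<in>carrier L.
        x \<sqinter>\<^bsub>L\<^esub> (y \<squnion>\<^bsub>L\<^esub> z) = (x \<sqinter>\<^bsub>L\<^esub> y) \<squnion>\<^bsub>L\<^esub> (x \<sqinter>\<^bsub>L\<^esub> z))"

end

theory Submission
  imports Defs
begin

text \<open>
  The faces of the completion are the angles of the map, so a zero-homologous difference of two
  orientations is the coboundary of an integer potential \<open>c\<close> on the angles. Around each
  edge-vertex, an EDGE labeling increases clockwise by 1 across incoming and by 0 across outgoing
  edges; hence adding \<open>c\<close> modulo 3 to a labeling for \<open>D0\<close> yields one for \<open>D\<close>, and every
  orientation homologous to \<open>D0\<close> is Schnyder.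

  Conversely, let \<open>D\<close> and \<open>D0\<close> have equal outdegrees. Equality at the primal vertices allows
  us to integrate the difference around each of them to a function \<open>p\<close> on the angles. What is left
  is a 1-cochain on the map, antisymmetric by equality at the edge-vertices and closed by equality
  at the dual vertices, whose sum along a cycle is half the difference of the values of \<open>gamma\<close>.
  Equality of types thus makes it vanish on a homology basis, so it is exact.

  Normalising the potentials to be 0 at \<open>f0\<close> identifies the class with a set of integer functions
  cut out by bounds on differences of two values. Such a set is closed under pointwise minimum and
  maximum, and the order is the reversed pointwise order.
\<close>

section \<open>Sublattices of function spaces\<close>

text \<open>The map \<open>h\<close> embeds the order, reversed, into functions with values in a
  chain, so joins are pointwise minima and meets pointwise maxima. Distributivity holds pointwise in
  the chain and is pulled back along the injective \<open>h\<close>.\<close>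

lemma distributive_lattice_of_heights:
  fixes L :: "('a, 'm) gorder_scheme" and h :: "'a \<Rightarrow> 'b \<Rightarrow> 'c::linorder"
  assumes eq: "eq L = (=)"
    and le: "\<And>x y. x \<in> carrier L \<Longrightarrow> y \<in> carrier L \<Longrightarrow> le L x y \<longleftrightarrow> (\<forall>a. h y a \<le> h x a)"
    and inj: "inj_on h (carrier L)"
    and min_closed: "\<And>x y. x \<in> carrier L \<Longrightarrow> y \<in> carrier L \<Longrightarrow>
      \<exists>z\<in>carrier L. \<forall>a. h z a = min (h x a) (h y a)"
    and max_closed: "\<And>x y. x \<in> carrier L \<Longrightarrow> y \<in> carrier L \<Longrightarrow>
      \<exists>z\<in>carrier L. \<forall>a. h z a = max (h x a) (h y a)"
  shows "distributive_lattice L"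
proof -
  interpret partial_order L
  proof unfold_locales
    fix x y assume "x \<sqsubseteq>\<^bsub>L\<^esub> y" "y \<sqsubseteq>\<^bsub>L\<^esub> x" "x \<in> carrier L" "y \<in> carrier L"
    then have "h x = h y"
      by (auto simp: le fun_eq_iff intro: order.antisym)
    with inj \<open>x \<in> carrier L\<close> \<open>y \<in> carrier L\<close> show "x .=\<^bsub>L\<^esub> y"
      by (simp add: eq inj_on_eq_iff)
  qed (auto simp: eq le intro: order.trans)
  have least: "least L z (Upper L {x, y})"
    if "x \<in> carrier L" "y \<in> carrier L" "z \<in> carrier L" "\<forall>a. h z a = min (h x a) (h y a)" for x y z
    using that by (auto simp: least_def Upper_def le)
  have greatest: "greatest L z (Lower L {x, y})"
    if "x \<in> carrier L" "y \<in> carrier L" "z \<in> carrier L" "\<forall>a. h z a = max (h x a) (h y a)" for x y z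
    using that by (auto simp: greatest_def Lower_def le)
  interpret lattice L
    by unfold_locales (meson least greatest min_closed max_closed)+
  have join: "h (x \<squnion>\<^bsub>L\<^esub> y) a = min (h x a) (h y a)"
    if xy: "x \<in> carrier L" "y \<in> carrier L" for x y a
  proof -
    obtain z where z: "z \<in> carrier L" "\<forall>a. h z a = min (h x a) (h y a)"
      using min_closed[OF xy] by blast
    \<comment> \<open>The join is defined by \<open>SOME\<close>; it equals \<open>z\<close> because
      least upper bounds are unique in a partial order.\<close>
    have "x \<squnion>\<^bsub>L\<^esub> y = z"
      using least[OF xy z] least_unique someI[of "\<lambda>s. least L s (Upper L {x, y})"]
      unfolding join_def sup_def by blast
    with z show ?thesis by simp
  qed
  have meet: "h (x \<sqinter>\<^bsub>L\<^esub> y) a = max (h x a) (h y a)"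
    if xy: "x \<in> carrier L" "y \<in> carrier L" for x y a
  proof -
    obtain z where z: "z \<in> carrier L" "\<forall>a. h z a = max (h x a) (h y a)"
      using max_closed[OF xy] by blast
    have "x \<sqinter>\<^bsub>L\<^esub> y = z"
      using greatest[OF xy z] greatest_unique someI[of "\<lambda>s. greatest L s (Lower L {x, y})"]
      unfolding meet_def inf_def by blast
    with z show ?thesis by simp
  qed
  have "x \<sqinter>\<^bsub>L\<^esub> (y \<squnion>\<^bsub>L\<^esub> z) = (x \<sqinter>\<^bsub>L\<^esub> y) \<squnion>\<^bsub>L\<^esub> (x \<sqinter>\<^bsub>L\<^esub> z)"
    if "x \<in> carrier L" "y \<in> carrier L" "z \<in> carrier L" for x y z
  proof (rule inj_onD[OF inj])
    show "h (x \<sqinter>\<^bsub>L\<^esub> (y \<squnion>\<^bsub>L\<^esub> z)) = h ((x \<sqinter>\<^bsub>L\<^esub> y) \<squnion>\<^bsub>L\<^esub> (x \<sqinter>\<^bsub>L\<^esub> z))"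
      using that by (simp add: fun_eq_iff join meet join_closed meet_closed max_min_distrib2)
  qed (use that in \<open>auto intro: join_closed meet_closed\<close>)
  then show ?thesis
    unfolding distributive_lattice_def using lattice_axioms by blast
qed


section \<open>Potentials\<close>

text \<open>Read \<open>P a s b\<close> as: some path of total weight \<open>s\<close> leads from
  \<open>a\<close> to \<open>b\<close>. If all loops have weight 0, path weights depend only on the
  end points, and the weight from a chosen root of the component is a potential. This is applied to
  iteration of a permutation and to walks in the map.\<close>

lemma potential_exists:
  fixes P :: "'a \<Rightarrow> 'b::ab_group_add \<Rightarrow> 'a \<Rightarrow> bool"
  assumes refl: "\<And>a. P a 0 a"
    and trans: "\<And>a b c s t. P a s b \<Longrightarrow> P b t c \<Longrightarrow> P a (s + t) c"
    and sym: "\<And>a b s. P a s b \<Longrightarrow> \<exists>t. P b t a"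
    and closed: "\<And>a s. P a s a \<Longrightarrow> s = 0"
  shows "\<exists>p. \<forall>a s b. P a s b \<longrightarrow> p b = p a + s"
proof -
  define root where "root a = (SOME e. \<exists>s. P e s a)" for a
  define p where "p a = (SOME s. P (root a) s a)" for a
  have p: "P (root a) (p a) a" for a
    unfolding p_def root_def by (metis (mono_tags, lifting) refl someI_ex)
  \<comment> \<open>Connected points are reachable from the same elements, so \<open>SOME\<close> is
    applied to the same predicate and picks the same root.\<close>
  have root: "root a = root b" if "P a s b" for a b s
    unfolding root_def by (rule arg_cong[of _ _ Eps]) (meson that sym trans ext)
  have "p b = p a + s" if path: "P a s b" for a b s
  proof -
    obtain u where u: "P b u (root b)"
      using p[of b] sym by blast
    have "p b + u = 0"
      using closed[OF trans[OF p[of b] u]] .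
    moreover have "p a + s + u = 0"
      using closed[OF trans[OF trans[OF p[of a, unfolded root[OF path]] path] u]] .
    ultimately show ?thesis by (simp add: add_eq_0_iff2)
  qed
  then show ?thesis by blast
qed

section \<open>Sums and integration along the orbits of a permutation\<close>

lemma permutation_bij: "bij f \<Longrightarrow> permutation (f :: 'a::finite \<Rightarrow> 'a)"
  by (simp add: permutation)

lemma bij_betw_orbit:
  assumes "bij (f :: 'a::finite \<Rightarrow> 'a)"
  shows "bij_betw f (orbit f a) (orbit f a)"
proof -
  have "f ` orbit f a = orbit f (f a)"
    by (rule orbit_inverse) (simp_all add: assms permutation_self_in_orbit permutation_bij)
  also have "\<dots> = orbit f a"
    using assms by (intro permutation_orbit_step permutation_bij)
  finally show ?thesis
    using assms by (auto simp: bij_betw_def bij_def intro: inj_on_subset)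
qed

lemma sum_orbit_shift:
  assumes "bij (f :: 'a::finite \<Rightarrow> 'a)"
  shows "(\<Sum>x\<in>orbit f a. u (f x)) = sum u (orbit f a)"
  using sum.reindex_bij_betw[OF bij_betw_orbit[OF assms]] .

text \<open>The prescribed increments are summed along iterates of \<open>f\<close>. The result is
  well defined because returning to the start means a whole number of turns around the orbit, each
  contributing 0.\<close>

lemma orbit_potential:
  fixes x :: "'a::finite \<Rightarrow> int"
  assumes f: "bij f" and x: "\<And>a. sum x (orbit f a) = 0"
  shows "\<exists>p. \<forall>a. p (f a) = p a + x a"
proof -
  define S where "S a n = (\<Sum>k<n. x ((f ^^ k) a))" for a n
  define P where "P a s b \<longleftrightarrow> (\<exists>n. (f ^^ n) a = b \<and> s = S a n)" for a s b
  have S_add: "S a (m + n) = S a m + S ((f ^^ m) a) n" for a m n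
    by (induction n) (simp_all add: S_def add.commute[of m] funpow_add)
  have S_closed: "S a n = 0" if "(f ^^ n) a = a" for a n
    using that
  \<comment> \<open>One full turn, of length \<open>funpow_dist1 f a a\<close>, is split off; its
    sum runs over the whole orbit and vanishes.\<close>
  proof (induction n rule: less_induct)
    case (less n)
    let ?m = "funpow_dist1 f a a"
    have self: "a \<in> orbit f a"
      using f by (intro permutation_self_in_orbit permutation_bij)
    note m = funpow_dist1_prop[OF self]
    have "S a ?m = sum x (orbit f a)"
      unfolding S_def orbit_conv_funpow_dist1[OF self] lessThan_atLeast0
      by (subst sum.reindex[OF inj_on_funpow_dist1[OF self]]) simp
    then have Sm: "S a ?m = 0"
      by (simp only: x)
    show ?case
    proof (cases "n = 0")
      case False
      then have "?m \<le> n"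
        using funpow_dist1_le_self[OF less.prems _ self] by simp
      then obtain k where k: "n = ?m + k"
        using le_Suc_ex by blast
      have "(f ^^ k) a = a"
        using less.prems m unfolding k by (metis add.commute funpow_add o_apply)
      then have "S a k = 0"
        using k by (intro less.IH) auto
      then show ?thesis
        unfolding k S_add m Sm by simp
    qed (simp add: S_def)
  qed
  have "\<exists>p. \<forall>a s b. P a s b \<longrightarrow> p b = p a + s"
  proof (rule potential_exists)
    show "P a 0 a" for a
      unfolding P_def S_def by (rule exI[of _ 0]) simp
    show "P a (s + t) c" if "P a s b" "P b t c" for a b c s t
      using that unfolding P_def by (metis S_add add.commute funpow_add o_apply)
    show "\<exists>t. P b t a" if "P a s b" for a b s
    proof -
      have "b \<in> orbit f a"
        using that f unfolding P_def
        by (metis funpow_in_orbit permutation_bij permutation_self_in_orbit)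
      then have "a \<in> orbit f b"
        using f by (metis orbit_swap permutation_bij permutation_self_in_orbit)
      then show ?thesis
        unfolding P_def orbit_altdef by blast
    qed
    show "s = 0" if "P a s a" for a s
      using that S_closed unfolding P_def by blast
  qed
  then obtain p where "\<And>a s b. P a s b \<Longrightarrow> p b = p a + s" by blast
  moreover have "P a (x a) (f a)" for a
    unfolding P_def S_def by (rule exI[of _ 1]) simp
  ultimately show ?thesis by blast
qed

text \<open>The sum telescopes. Both ends are excluded, so the last dart counted is the predecessor
  of \<open>b\<close>. For \<open>a = b\<close> the sector is a full turn without
  \<open>a\<close>.\<close>

lemma sum_darts_between:
  fixes u p :: "'a \<Rightarrow> int"
  assumes r: "inj (rot M)" and b: "b \<in> orbit (rot M) a"
    and p: "\<And>e. u (rot M e) = p (rot M e) - p e"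
  shows "sum u (darts_between M a b) = p (inv (rot M) b) - p a"
proof -
  \<comment> \<open>Thus \<open>m\<close> is the number of darts strictly between: turning from
    \<open>a\<close>, the dart \<open>b\<close> is first met after \<open>Suc m\<close>
    steps.\<close>
  define m where "m = funpow_dist (rot M) (rot M a) b"
  have m: "(rot M ^^ Suc m) a = b"
    using funpow_dist1_prop[OF b] by (simp only: m_def)
  have least: "(rot M ^^ n) a \<noteq> b" if "0 < n" "n < Suc m" for n
    using funpow_dist1_least[of n "rot M" a b] that unfolding m_def by blast
  have "darts_between M a b = (\<lambda>k. (rot M ^^ Suc k) a) ` {..<m}"
  proof (intro equalityI subsetI)
    fix e assume "e \<in> darts_between M a b"
    then obtain k where k: "e = (rot M ^^ k) a" "0 < k"
      "\<And>j. 0 < j \<Longrightarrow> j \<le> k \<Longrightarrow> (rot M ^^ j) a \<noteq> b"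
      by (auto simp: darts_between_def)
    then have "k < Suc m"
      using k(3)[of "Suc m"] m by (metis not_less zero_less_Suc)
    with k show "e \<in> (\<lambda>k. (rot M ^^ Suc k) a) ` {..<m}"
      by (intro image_eqI[of _ _ "k - 1"]) auto
  next
    fix e assume "e \<in> (\<lambda>k. (rot M ^^ Suc k) a) ` {..<m}"
    then obtain k where k: "e = (rot M ^^ Suc k) a" "k < m" by blast
    show "e \<in> darts_between M a b"
      unfolding darts_between_def using least k
      by (intro CollectI exI[of _ "Suc k"]) auto
  qed
  moreover have "inj_on (\<lambda>k. (rot M ^^ Suc k) a) {..<m}"
    using inj_on_funpow_dist1[OF b] unfolding inj_on_def m_def[symmetric]
    by (metis Suc_inject Suc_less_eq atLeastLessThan_iff lessThan_iff zero_le)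
  ultimately have "sum u (darts_between M a b) = (\<Sum>k<m. u ((rot M ^^ Suc k) a))"
    by (simp only: sum.reindex o_def)
  also have "\<dots> = (\<Sum>k<m. p ((rot M ^^ Suc k) a) - p ((rot M ^^ k) a))"
    by (simp add: p)
  also have "\<dots> = p ((rot M ^^ m) a) - p a"
    using sum_lessThan_telescope[of "\<lambda>k. p ((rot M ^^ k) a)" m] by simp
  also have "(rot M ^^ m) a = inv (rot M) b"
    using m r by (metis funpow.simps(2) inv_f_f o_apply)
  finally show ?thesis .
qed


section \<open>Edge labels\<close>

text \<open>The four cyclic increments sum to 0 modulo 3. If each is 0 or 1, then either none or
  exactly three of them are 1. The first case is type 0; in the second the single increment 0 sits
  between the two equal labels and determines the rotation.\<close>

lemma label_steps_iff:
  fixes A B C E :: 3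
  shows "(\<exists>i. [A, B, C, E] = [i, i, i, i]) \<or> (\<exists>k i. rotate k [A, B, C, E] = [i - 1, i, i, i + 1])
    \<longleftrightarrow> B - A \<in> {0, 1} \<and> C - B \<in> {0, 1} \<and> E - C \<in> {0, 1} \<and> A - E \<in> {0, 1}"
    (is "?L \<longleftrightarrow> ?R")
proof
  assume ?L
  then show ?R
  proof (elim disjE exE)
    fix k i assume "rotate k [A, B, C, E] = [i - 1, i, i, i + 1]"
    then have *: "rotate (k mod 4) [A, B, C, E] = [i - 1, i, i, i + 1]"
      using rotate_conv_mod[of k "[A, B, C, E]"] by simp
    consider "k mod 4 = 0" | "k mod 4 = 1" | "k mod 4 = 2" | "k mod 4 = 3"
      by linarith
    then have "[A, B, C, E] \<in> {[i - 1, i, i, i + 1], [i + 1, i - 1, i, i], [i, i + 1, i - 1, i],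
        [i, i, i + 1, i - 1]}"
      using * by cases (simp_all add: numeral_2_eq_2 numeral_3_eq_3)
    then show ?R by auto
  qed auto
next
  assume R: ?R
  define b c e a where "b = B - A" and "c = C - B" and "e = E - C" and "a = A - E"
  have steps: "B = A + b" "C = A + b + c" "E = A + b + c + e" "b + c + e + a = 0"
    by (simp_all add: b_def c_def e_def a_def)
  have bits: "b \<in> {0, 1}" "c \<in> {0, 1}" "e \<in> {0, 1}" "a \<in> {0, 1}"
    using R unfolding b_def c_def e_def a_def by blast+
  have three: "x + 1 + 1 = x - 1" "x + 1 + 1 + 1 = x" for x :: 3
    by (simp_all add: add.assoc eq_diff_eq)
  \<comment> \<open>The increment \<open>a\<close> is fixed by the zero sum, which rules out one,
    two or four ones.\<close>
  consider "b = 0" "c = 0" "e = 0" | "b = 0" "c = 1" "e = 1" | "b = 1" "c = 0" "e = 1"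
    | "b = 1" "c = 1" "e = 0" | "b = 1" "c = 1" "e = 1"
    using bits steps(4) by (elim insertE emptyE) simp_all
  then show ?L
  proof cases
    case 2
    then have "rotate 3 [A, B, C, E] = [A - 1, A, A, A + 1]"
      by (simp add: steps numeral_3_eq_3 three)
    then show ?thesis by blast
  next
    case 3
    then have "rotate 0 [A, B, C, E] = [B - 1, B, B, B + 1]"
      by (simp add: steps)
    then show ?thesis by blast
  next
    case 4
    then have "rotate 1 [A, B, C, E] = [C - 1, C, C, C + 1]"
      by (simp add: steps three)
    then show ?thesis by blast
  next
    case 5
    then have "rotate 2 [A, B, C, E] = [E - 1, E, E, E + 1]"
      by (simp add: steps numeral_2_eq_2 three)
    then show ?thesis by blast
  qed (simp add: steps)
qed


section \<open>Faces and vertices of the completion\<close>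

lemma completion_simps [simp]:
  "rot (completion M) = hat_rot M" "opp (completion M) = hat_opp"
  by (simp_all add: completion_def)

lemma finite_hat_darts [simp]: "finite (A :: 'a::finite hat_dart set)"
proof -
  have "x \<in> range PV \<union> range PE \<union> range DV \<union> range DE" for x :: "'a hat_dart"
    by (cases x) simp_all
  then have "finite (UNIV :: 'a hat_dart set)"
    by (rule_tac finite_subset[of _ "range PV \<union> range PE \<union> range DV \<union> range DE"]) auto
  then show ?thesis
    by (rule finite_subset[OF subset_UNIV])
qed

locale cell_map =
  fixes G :: "'a::finite cmap"
  assumes combinatorial_map: "combinatorial_map G"
begin

abbreviation prev :: "'a \<Rightarrow> 'a" where "prev \<equiv> inv (rot G)"

lemma bij_rot: "bij (rot G)"
  and opp_opp [simp]: "opp G (opp G d) = d"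
  and opp_neq [simp]: "opp G d \<noteq> d"
  and connected: "connected_cmap G"
  using combinatorial_map unfolding combinatorial_map_def by auto

lemma rot_prev [simp]: "rot G (prev d) = d"
  using bij_rot by (simp add: bij_is_surj surj_f_inv_f)

lemma prev_rot [simp]: "prev (rot G d) = d"
  using bij_rot by (simp add: bij_is_inj)

lemma prev_opp [simp]: "prev (opp G d) = face_next G d"
  by (simp add: face_next_def)

lemma face_next_opp [simp]: "face_next G (opp G d) = prev d"
  by (simp add: face_next_def del: prev_opp)

lemma rot_face_next [simp]: "rot G (face_next G d) = opp G d"
  by (simp add: face_next_def del: prev_opp)

lemma opp_eq_iff [simp]: "opp G d = opp G e \<longleftrightarrow> d = e"
  by (metis opp_opp)

lemma rot_eq_iff [simp]: "rot G d = rot G e \<longleftrightarrow> d = e"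
  by (metis prev_rot)

lemma face_next_eq_iff [simp]: "face_next G d = face_next G e \<longleftrightarrow> d = e"
  by (metis rot_face_next opp_opp)

lemma bij_face_next: "bij (face_next G)"
  by (rule o_bij[of "\<lambda>d. opp G (rot G d)"]) (auto simp: fun_eq_iff)

lemma inj_hat_rot: "inj (hat_rot G)"
proof (rule injI)
  fix x y assume "hat_rot G x = hat_rot G y"
  then show "x = y" by (cases x; cases y) simp_all
qed

lemma face_next_completion [simp]:
  "face_next (completion G) (PV a) = DE a"
  "face_next (completion G) (DE a) = DV (opp G (rot G a))"
  "face_next (completion G) (DV a) = PE (opp G a)"
  "face_next (completion G) (PE a) = PV (prev a)"
  by (simp_all add: face_next_def[of "completion G"] inv_f_eq[OF inj_hat_rot])

text \<open>Each face is a quadrilateral. Its walk goes from the primal vertex to the edge-vertex of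
  \<open>a\<close>, on to the dual vertex, to the edge-vertex of \<open>rot G a\<close> and
  back.\<close>

lemma angle_face_eq: "angle_face G a = {PV a, DE a, DV (opp G (rot G a)), PE (rot G a)}"
proof -
  have 4: "(face_next (completion G) ^^ 4) (PV a) = PV a"
    by (simp add: numeral_eq_Suc)
  have "angle_face G a = (\<lambda>m. (face_next (completion G) ^^ m) (PV a)) ` {..<4}"
    unfolding angle_face_def using orbit_altdef_bounded[OF 4] by auto
  also have "{..<4} = {0, 1, 2, 3 :: nat}" by auto
  finally show ?thesis
    by (simp add: numeral_eq_Suc)
qed

lemma mem_angle_face [simp]:
  "PV d \<in> angle_face G a \<longleftrightarrow> a = d"
  "PE d \<in> angle_face G a \<longleftrightarrow> a = prev d"
  "DV d \<in> angle_face G a \<longleftrightarrow> a = face_next G d"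
  "DE d \<in> angle_face G a \<longleftrightarrow> a = d"
proof -
  show "DV d \<in> angle_face G a \<longleftrightarrow> a = face_next G d"
    unfolding angle_face_eq by (auto simp: face_next_def simp del: prev_opp)
qed (auto simp: angle_face_eq)

lemma inj_angle_face: "inj (angle_face G)"
  by (rule injI) (metis mem_angle_face(1))

lemma faces_completion: "faces (completion G) = range (angle_face G)"
proof -
  \<comment> \<open>An orbit containing its starting dart is also the orbit of the next dart. Going
    once around the quadrilateral settles all four kinds of darts.\<close>
  have step: "orbit (face_next (completion G)) (face_next (completion G) x) = angle_face G a"
    if "orbit (face_next (completion G)) x = angle_face G a" "x \<in> angle_face G a" for x a
    using self_in_orbit_step[of x "face_next (completion G)"] that by simp
  have PV: "orbit (face_next (completion G)) (PV a) = angle_face G a" for a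
    by (simp add: angle_face_def)
  have DE: "orbit (face_next (completion G)) (DE a) = angle_face G a" for a
    using step[OF PV[of a]] by simp
  have DV: "orbit (face_next (completion G)) (DV a) = angle_face G (face_next G a)" for a
    using step[OF DE[of "face_next G a"]] by simp
  have PE: "orbit (face_next (completion G)) (PE a) = angle_face G (prev a)" for a
    using step[OF DV[of "opp G a"]] by simp
  have "\<exists>a. orbit (face_next (completion G)) x = angle_face G a" for x
    by (cases x) (auto simp: PV DE DV PE)
  then show ?thesis
    unfolding faces_def by (auto simp: image_iff) (metis PV)
qed

lemma orbit_rot_self [simp]: "d \<in> orbit (rot G) d"
  and orbit_face_next_self [simp]: "d \<in> orbit (face_next G) d"
  by (simp_all add: permutation_self_in_orbit permutation_bij bij_rot bij_face_next)

lemma orbit_PV: "orbit (hat_rot G) (PV d) = PV ` orbit (rot G) d"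
  by (rule orbit_inverse[symmetric]) simp_all

lemma orbit_DV: "orbit (hat_rot G) (DV d) = DV ` orbit (face_next G) d"
  by (rule orbit_inverse[symmetric]) simp_all

lemma orbit_PE: "orbit (hat_rot G) (PE d) = {PE d, DE (opp G d), PE (opp G d), DE d}"
proof -
  have 4: "(hat_rot G ^^ 4) (PE d) = PE d"
    by (simp add: numeral_eq_Suc)
  have "orbit (hat_rot G) (PE d) = (\<lambda>m. (hat_rot G ^^ m) (PE d)) ` {..<4}"
    using orbit_altdef_bounded[OF 4] by auto
  also have "{..<4} = {0, 1, 2, 3 :: nat}" by auto
  finally show ?thesis
    by (simp add: numeral_eq_Suc)
qed

lemma vertices_completion:
  "vertices (completion G) = range (\<lambda>d. PV ` orbit (rot G) d) \<union> range (\<lambda>d. DV ` orbit (face_next G) d)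
    \<union> range (\<lambda>d. {PE d, DE (opp G d), PE (opp G d), DE d})" (is "_ = ?R")
proof -
  have "orbit (hat_rot G) (DE d) = orbit (hat_rot G) (PE (opp G d))" for d
    using self_in_orbit_step[of "PE (opp G d)" "hat_rot G"] by (simp add: orbit_PE)
  then have "orbit (hat_rot G) x \<in> ?R" for x
    by (cases x) (auto simp: orbit_PV orbit_DV orbit_PE)
  then show ?thesis
    unfolding vertices_def completion_simps
    by (auto simp flip: orbit_PV orbit_DV orbit_PE)
qed


section \<open>Orientations that differ by a potential on the angles\<close>

lemma orientation_completion_iff:
  "orientation (completion G) D \<longleftrightarrow> (\<forall>d. PV d \<in> D \<longleftrightarrow> PE d \<notin> D) \<and> (\<forall>d. DV d \<in> D \<longleftrightarrow> DE d \<notin> D)"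
proof
  assume "orientation (completion G) D"
  then have "x \<in> D \<longleftrightarrow> hat_opp x \<notin> D" for x
    unfolding orientation_def completion_simps by blast
  from this[of "PV _"] this[of "DV _"]
  show "(\<forall>d. PV d \<in> D \<longleftrightarrow> PE d \<notin> D) \<and> (\<forall>d. DV d \<in> D \<longleftrightarrow> DE d \<notin> D)"
    unfolding hat_opp.simps by blast
next
  assume *: "(\<forall>d. PV d \<in> D \<longleftrightarrow> PE d \<notin> D) \<and> (\<forall>d. DV d \<in> D \<longleftrightarrow> DE d \<notin> D)"
  have "x \<in> D \<longleftrightarrow> hat_opp x \<notin> D" for x
    by (cases x) (simp_all add: *)
  then show "orientation (completion G) D"
    unfolding orientation_def completion_simps by blast
qed

text \<open>For two orientations this is antisymmetric under reversal of darts; it is the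
  characteristic flow of \<open>D - D'\<close>, freed from the choice of a reference
  orientation.\<close>

definition orient_diff :: "'a hat_dart set \<Rightarrow> 'a hat_dart set \<Rightarrow> 'a hat_dart \<Rightarrow> int" where
  "orient_diff D D' x = of_bool (x \<in> D) - of_bool (x \<in> D')"

text \<open>The function \<open>c\<close> is a 2-chain on the faces of the completion with boundary
  \<open>orient_diff D D'\<close>: each value is \<open>c\<close> on the left of the dart minus
  \<open>c\<close> on its right. One dart per edge is listed, the one leaving the
  edge-vertex.\<close>

definition potential :: "'a hat_dart set \<Rightarrow> 'a hat_dart set \<Rightarrow> ('a \<Rightarrow> int) \<Rightarrow> bool" where
  "potential D D' c \<longleftrightarrow>
     (\<forall>d. orient_diff D D' (PE d) = c (prev d) - c d) \<and>
     (\<forall>d. orient_diff D D' (DE d) = c d - c (face_next G d))"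

lemma orient_diff_hat_opp:
  assumes "orientation (completion G) D" "orientation (completion G) D'"
  shows "orient_diff D D' (PV d) = - orient_diff D D' (PE d)"
    "orient_diff D D' (DV d) = - orient_diff D D' (DE d)"
  using assms by (simp_all add: orient_diff_def orientation_completion_iff)

text \<open>Both flows vanish off \<open>Rh\<close> and are restrictions to \<open>Rh\<close> of
  functions antisymmetric under reversal. Since \<open>Rh\<close> contains one dart of each edge,
  agreement there is agreement on the darts leaving edge-vertices.\<close>

lemma subgraph_flow_diff_eq_iff_potential:
  assumes D: "orientation (completion G) D" "orientation (completion G) D'"
    and R: "orientation (completion G) Rh"
  shows "(\<forall>x. subgraph_flow (completion G) Rh (D - D') x =
      (\<Sum>a\<in>UNIV. c a * subgraph_flow (completion G) Rh (angle_face G a) x)) \<longleftrightarrow> potential D D' c"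
proof -
  \<comment> \<open>This is the coefficient of the face left of \<open>x\<close> minus that of the
    face right of \<open>x\<close>.\<close>
  define s where "s x = (\<Sum>a\<in>UNIV. c a * (of_bool (x \<in> angle_face G a) - of_bool (hat_opp x \<in> angle_face G a)))" for x
  have s: "s (PV d) = c d - c (prev d)" "s (PE d) = c (prev d) - c d"
    "s (DV d) = c (face_next G d) - c d" "s (DE d) = c d - c (face_next G d)" for d
    by (simp_all add: s_def of_bool_def right_diff_distrib sum_subtractf if_distrib[of "(*) x" for x]
        cong: if_cong)
  have "(\<Sum>a\<in>UNIV. c a * subgraph_flow (completion G) Rh (angle_face G a) x) =
      (if x \<in> Rh then s x else 0)" for x
    by (simp add: subgraph_flow_def s_def)
  moreover have "subgraph_flow (completion G) Rh (D - D') x = (if x \<in> Rh then orient_diff D D' x else 0)" for x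
  proof -
    have "hat_opp x \<in> D \<longleftrightarrow> x \<notin> D" "hat_opp x \<in> D' \<longleftrightarrow> x \<notin> D'"
      using D unfolding orientation_def completion_simps by blast+
    then show ?thesis
      by (simp add: subgraph_flow_def orient_diff_def of_bool_def)
  qed
  ultimately have "(\<forall>x. subgraph_flow (completion G) Rh (D - D') x =
      (\<Sum>a\<in>UNIV. c a * subgraph_flow (completion G) Rh (angle_face G a) x)) \<longleftrightarrow>
      (\<forall>x\<in>Rh. orient_diff D D' x = s x)"
    by auto
  also have "\<dots> \<longleftrightarrow> potential D D' c"
  proof
    assume *: "\<forall>x\<in>Rh. orient_diff D D' x = s x"
    have "orient_diff D D' (PE d) = s (PE d)" for d
      using *[rule_format, of "PE d"] *[rule_format, of "PV d"] R orient_diff_hat_opp(1)[OF D, of d]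
      by (cases "PE d \<in> Rh") (auto simp: orientation_completion_iff s)
    moreover have "orient_diff D D' (DE d) = s (DE d)" for d
      using *[rule_format, of "DE d"] *[rule_format, of "DV d"] R orient_diff_hat_opp(2)[OF D, of d]
      by (cases "DE d \<in> Rh") (auto simp: orientation_completion_iff s)
    ultimately show "potential D D' c"
      by (simp add: potential_def s)
  next
    assume "potential D D' c"
    then have "orient_diff D D' x = s x" for x
      by (cases x) (simp_all add: potential_def orient_diff_hat_opp[OF D] s)
    then show "\<forall>x\<in>Rh. orient_diff D D' x = s x" by blast
  qed
  finally show ?thesis .
qed

lemma orientation_le_iff:
  assumes D: "orientation (completion G) D" "orientation (completion G) D'"
    and R: "orientation (completion G) Rh"
  shows "orientation_le (completion G) Rh (angle_face G a0) D D' \<longleftrightarrow>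
    (\<exists>c. potential D D' c \<and> c a0 = 0 \<and> (\<forall>a. 0 \<le> c a))" (is "?L \<longleftrightarrow> ?R")
proof -
  let ?f = "subgraph_flow (completion G) Rh"
  have faces: "(\<Sum>F\<in>faces (completion G). c F * ?f F x) = (\<Sum>a\<in>UNIV. c (angle_face G a) * ?f (angle_face G a) x)"
    for c and x
    unfolding faces_completion by (simp add: sum.reindex[OF inj_angle_face])
  \<comment> \<open>Omitting the face \<open>f0\<close> from the sum means giving it coefficient
    0.\<close>
  have faces': "(\<Sum>F\<in>faces (completion G) - {angle_face G a0}. c F * ?f F x) =
      (\<Sum>F\<in>faces (completion G). (if F = angle_face G a0 then 0 else c F) * ?f F x)" for c and x
    by (rule sum.mono_neutral_cong_left) (auto simp: faces_completion)
  note iff = subgraph_flow_diff_eq_iff_potential[OF D R]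
  show ?thesis
  proof
    assume ?L
    then obtain c :: "'a hat_dart set \<Rightarrow> nat" where
      "\<And>x. ?f (D - D') x = (\<Sum>F\<in>faces (completion G) - {angle_face G a0}. int (c F) * ?f F x)"
      unfolding orientation_le_def counterclockwise_def by blast
    then have "potential D D' (\<lambda>a. if angle_face G a = angle_face G a0 then 0 else int (c (angle_face G a)))"
      (is "potential D D' ?c")
      unfolding iff[symmetric] faces' faces by simp
    moreover have "?c a0 = 0" "\<forall>a. 0 \<le> ?c a" by simp_all
    ultimately show ?R by blast
  next
    assume ?R
    then obtain c where c: "potential D D' c" "c a0 = 0" "\<And>a. 0 \<le> c a" by blast
    define c' where "c' F = c (inv (angle_face G) F)" for F
    have c': "c' (angle_face G a) = c a" for a
      by (simp add: c'_def inj_angle_face)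
    have flow: "?f (D - D') x = (\<Sum>F\<in>faces (completion G). c' F * ?f F x)" for x
      using c(1) unfolding iff[symmetric] faces c' by blast
    also have "(\<Sum>F\<in>faces (completion G). c' F * ?f F x) =
        (\<Sum>F\<in>faces (completion G) - {angle_face G a0}. int (nat (c' F)) * ?f F x)" for x
      unfolding faces' by (rule sum.cong) (auto simp: c' c'_def c inj_angle_face)
    finally show ?L
      unfolding orientation_le_def counterclockwise_def zero_homologous_def
      using flow by (intro conjI) (rule exI[of _ c'], simp, rule exI[of _ "\<lambda>F. nat (c' F)"], simp)
  qed
qed

lemma constant_if_rot_opp_invariant:
  assumes "\<And>d. c (rot G d) = c d" "\<And>d. c (opp G d) = c d"
  shows "c d = c d'"
proof -
  have "(d, d') \<in> ({(x, rot G x) | x. True} \<union> {(x, opp G x) | x. True})\<^sup>*"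
    using connected unfolding connected_cmap_def by blast
  then show ?thesis
    by (induction rule: rtrancl_induct) (auto simp: assms)
qed

text \<open>The difference of two potentials does not change across any edge of the completion, so
  it is invariant under \<open>rot\<close> and \<open>face_next\<close>, hence under
  \<open>opp\<close>, which is \<open>face_next\<close> followed by \<open>rot\<close>. By
  connectedness it is constant.\<close>

lemma potential_unique:
  assumes c: "potential D D' c" "potential D D' c'" and a0: "c a0 = c' a0"
  shows "c = c'"
proof
  fix a
  let ?u = "\<lambda>d. c d - c' d"
  have 1: "?u (rot G d) = ?u d" for d
    using c unfolding potential_def by (smt (verit) prev_rot)
  have 2: "?u (face_next G d) = ?u d" for d
    using c unfolding potential_def by (smt (verit))
  have "?u (opp G d) = ?u d" for d
    using 1[of "face_next G d"] 2[of d] by simp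
  with 1 have "?u a = ?u a0"
    by (rule constant_if_rot_opp_invariant)
  with a0 show "c a = c' a" by simp
qed

lemma potential_compose:
  "potential D D' c \<Longrightarrow> potential D' D'' c' \<Longrightarrow> potential D D'' (\<lambda>a. c a + c' a)"
  unfolding potential_def orient_diff_def by (smt (verit))

lemma potential_converse: "potential D D' c \<Longrightarrow> potential D' D (\<lambda>a. - c a)"
  unfolding potential_def orient_diff_def by (smt (verit))

lemma potential_shift: "potential D D' c \<Longrightarrow> potential D D' (\<lambda>a. c a - k)"
  unfolding potential_def by simp

lemma eq_if_potential_0:
  assumes "orientation (completion G) D" "orientation (completion G) D'" "potential D D' (\<lambda>a. 0)"
  shows "D = D'"
proof -
  have "x \<in> D \<longleftrightarrow> x \<in> D'" for x
    using assms
    by (cases x) (auto simp: potential_def orient_diff_def orientation_completion_iff of_bool_def split: if_splits)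
  then show ?thesis by blast
qed

text \<open>A potential against \<open>D0\<close> is subject to the bounds that its step across each
  edge, added to the indicator of \<open>D0\<close>, is 0 or 1. Pointwise minimum and maximum
  preserve bounds on differences, so the result again describes an orientation.\<close>

lemma potential_min_max:
  assumes c: "potential D1 D0 c1" "potential D2 D0 c2"
    and m: "m = (min :: int \<Rightarrow> _) \<or> m = max"
  shows "\<exists>D. orientation (completion G) D \<and> potential D D0 (\<lambda>a. m (c1 a) (c2 a))"
proof -
  let ?c = "\<lambda>a. m (c1 a) (c2 a)"
  \<comment> \<open>\<open>p d\<close> and \<open>q d\<close> decide whether the primal and the dual
    half-edge of \<open>d\<close> leave the edge-vertex in the orientation to be built.\<close>
  define p where "p d \<longleftrightarrow> of_bool (PE d \<in> D0) + ?c (prev d) - ?c d = 1" for d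
  define q where "q d \<longleftrightarrow> of_bool (DE d \<in> D0) + ?c d - ?c (face_next G d) = 1" for d
  define D where "D = PE ` {d. p d} \<union> PV ` {d. \<not> p d} \<union> DE ` {d. q d} \<union> DV ` {d. \<not> q d}"
  have range: "of_bool (x \<in> D0) + orient_diff D' D0 x \<in> {0, 1}" for x D'
    by (auto simp: orient_diff_def)
  have mem: "PE d \<in> D \<longleftrightarrow> p d" "DE d \<in> D \<longleftrightarrow> q d" "PV d \<in> D \<longleftrightarrow> \<not> p d" "DV d \<in> D \<longleftrightarrow> \<not> q d" for d
    by (auto simp: D_def)
  have bit: "t \<in> {0, 1} \<longleftrightarrow> 0 \<le> t \<and> t \<le> 1" for t :: int
    by auto
  have m: "e + m x y - m z w \<in> {0, 1}" if "e + (x - z) \<in> {0, 1}" "e + (y - w) \<in> {0, 1}" for e x y z w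
    using m that unfolding bit by (auto simp: min_def max_def)
  have p: "of_bool (PE d \<in> D0) + ?c (prev d) - ?c d \<in> {0, 1}" for d
    using range[of "PE d" D1] range[of "PE d" D2] c unfolding potential_def by (intro m) metis+
  have q: "of_bool (DE d \<in> D0) + ?c d - ?c (face_next G d) \<in> {0, 1}" for d
    using range[of "DE d" D1] range[of "DE d" D2] c unfolding potential_def by (intro m) metis+
  have "of_bool (t = 1) = t" if "t \<in> {0, 1}" for t :: int
    using that by auto
  then have "potential D D0 ?c"
    unfolding potential_def orient_diff_def mem p_def q_def using p q by simp
  moreover have "orientation (completion G) D"
    by (simp add: orientation_completion_iff mem)
  ultimately show ?thesis by blast
qed

lemma distributive_lattice_potential_class:
  assumes S: "\<And>D. D \<in> S \<longleftrightarrow> orientation (completion G) D \<and> (\<exists>c. potential D D0 c)"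
    and R: "orientation (completion G) Rh"
  shows "distributive_lattice
    \<lparr>carrier = S, eq = (=), le = orientation_le (completion G) Rh (angle_face G a0)\<rparr>"
proof -
  \<comment> \<open>The height of \<open>D\<close> is its potential against \<open>D0\<close>
    normalised at \<open>a0\<close>; by \<open>potential_unique\<close> it is the only one.\<close>
  define h where "h D = (SOME c. potential D D0 c \<and> c a0 = 0)" for D
  have h: "potential D D0 (h D)" "h D a0 = 0" if D: "D \<in> S" for D
  proof -
    obtain c where "potential D D0 c" using D unfolding S by blast
    then have "potential D D0 (\<lambda>a. c a - c a0) \<and> c a0 - c a0 = 0"
      using potential_shift by simp
    then show "potential D D0 (h D)" "h D a0 = 0"
      unfolding h_def by (metis (mono_tags, lifting) someI_ex)+
  qed
  have h_unique: "h D = c" if "D \<in> S" "potential D D0 c" "c a0 = 0" for D c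
    using potential_unique h that by metis
  have diff: "potential D D' (\<lambda>a. h D a - h D' a)" if "D \<in> S" "D' \<in> S" for D D'
    using potential_compose[OF h(1) potential_converse[OF h(1)], OF that] by simp
  have closed: "\<exists>D\<in>S. \<forall>a. h D a = m (h D1 a) (h D2 a)"
    if D12: "D1 \<in> S" "D2 \<in> S" and m: "m = min \<or> m = max" for D1 D2 m
  proof -
    obtain D where D: "orientation (completion G) D" "potential D D0 (\<lambda>a. m (h D1 a) (h D2 a))"
      using potential_min_max[OF h(1)[OF D12(1)] h(1)[OF D12(2)] m] by blast
    then have "D \<in> S" unfolding S by blast
    moreover have "h D = (\<lambda>a. m (h D1 a) (h D2 a))"
      using D12 h(2) m by (intro h_unique D \<open>D \<in> S\<close>) auto
    ultimately show ?thesis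
      by (intro bexI[of _ D]) auto
  qed
  show ?thesis
  proof (rule distributive_lattice_of_heights[where h = h], simp_all)
    fix D D' assume DD': "D \<in> S" "D' \<in> S"
    then have "orientation_le (completion G) Rh (angle_face G a0) D D' \<longleftrightarrow>
        (\<exists>c. potential D D' c \<and> c a0 = 0 \<and> (\<forall>a. 0 \<le> c a))"
      using S R by (intro orientation_le_iff) auto
    also have "\<dots> \<longleftrightarrow> (\<forall>a. 0 \<le> h D a - h D' a)"
    proof
      assume "\<exists>c. potential D D' c \<and> c a0 = 0 \<and> (\<forall>a. 0 \<le> c a)"
      then obtain c where c: "potential D D' c" "c a0 = 0" "\<forall>a. 0 \<le> c a" by blast
      \<comment> \<open>The difference of heights is the only potential from \<open>D\<close> to
        \<open>D'\<close> that vanishes at \<open>a0\<close>, so the sign condition of the order can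
        be read off from the heights.\<close>
      have "c = (\<lambda>a. h D a - h D' a)"
        using DD' c by (intro potential_unique[of D D' _ _ a0] diff) (auto simp: h)
      with c(3) show "\<forall>a. 0 \<le> h D a - h D' a" by simp
    next
      assume "\<forall>a. 0 \<le> h D a - h D' a"
      then show "\<exists>c. potential D D' c \<and> c a0 = 0 \<and> (\<forall>a. 0 \<le> c a)"
        using diff[OF DD'] h(2) DD' by (intro exI[of _ "\<lambda>a. h D a - h D' a"]) auto
    qed
    finally show "orientation_le (completion G) Rh (angle_face G a0) D D' \<longleftrightarrow> (\<forall>a. h D' a \<le> h D a)"
      by simp
  next
    show "inj_on h S"
    proof (rule inj_onI)
      fix D D' assume *: "D \<in> S" "D' \<in> S" "h D = h D'"
      then show "D = D'"
        using diff[of D D'] S by (intro eq_if_potential_0) auto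
    qed
  qed (use closed in auto)
qed


section \<open>Schnyder orientations\<close>

text \<open>Of the four clockwise steps around an edge, the two listed are the first and the last;
  the other two are those listed for the opposite dart.\<close>

lemma EDGE_iff:
  "EDGE G l \<longleftrightarrow> (\<forall>d. l (face_next G d) - l d \<in> {0, 1} \<and> l d - l (prev d) \<in> {0, 1})"
proof -
  have "EDGE G l \<longleftrightarrow> (\<forall>d. l (face_next G d) - l d \<in> {0, 1} \<and> l (opp G d) - l (face_next G d) \<in> {0, 1} \<and>
      l (prev d) - l (opp G d) \<in> {0, 1} \<and> l d - l (prev d) \<in> {0, 1})"
    unfolding EDGE_def edge_type_0_def edge_type_1_or_2_def rotate_map[symmetric] edge_angles_def
    by (simp only: list.map label_steps_iff prev_opp)
  also have "\<dots> \<longleftrightarrow> (\<forall>d. l (face_next G d) - l d \<in> {0, 1} \<and> l d - l (prev d) \<in> {0, 1})"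
    by (metis face_next_opp prev_opp)
  finally show ?thesis .
qed

text \<open>Combining \<open>EDGE\<close> with the orientation rule turns the labeling into a
  potential modulo 3: clockwise around an edge-vertex the label grows by one exactly across the
  half-edges directed towards it.\<close>

lemma schnyder_orientation_iff:
  "schnyder_orientation G D \<longleftrightarrow> orientation (completion G) D \<and>
    (\<exists>l :: 'a \<Rightarrow> 3. \<forall>d. l (face_next G d) = l d + of_bool (DE d \<notin> D) \<and>
       l d = l (prev d) + of_bool (PE d \<notin> D))"
proof -
  have key: "v - u \<in> {0, 1} \<and> (b \<longleftrightarrow> u = v) \<longleftrightarrow> v = u + of_bool (\<not> b)" for u v :: 3 and b
    by (cases b) (auto simp: diff_eq_eq add.commute)
  have "EDGE G l \<and> (\<forall>x \<in> range PE \<union> range DE. \<forall>a a'.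
        x \<in> angle_face G a \<and> opp (completion G) x \<in> angle_face G a' \<longrightarrow> (x \<in> D \<longleftrightarrow> l a = l a')) \<longleftrightarrow>
      (\<forall>d. l (face_next G d) = l d + of_bool (DE d \<notin> D) \<and> l d = l (prev d) + of_bool (PE d \<notin> D))"
    (is "?L \<longleftrightarrow> ?R") for l :: "'a \<Rightarrow> 3"
  proof -
    have "?L \<longleftrightarrow> (\<forall>d. l (face_next G d) - l d \<in> {0, 1} \<and> l d - l (prev d) \<in> {0, 1} \<and>
        (PE d \<in> D \<longleftrightarrow> l (prev d) = l d) \<and> (DE d \<in> D \<longleftrightarrow> l d = l (face_next G d)))"
      unfolding EDGE_iff ball_Un by auto
    also have "\<dots> \<longleftrightarrow> ?R"
      unfolding key[symmetric] by blast
    finally show ?thesis .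
  qed
  then show ?thesis
    unfolding schnyder_orientation_def by blast
qed

lemma schnyder_orientation_potential:
  assumes D0: "schnyder_orientation G D0" and D: "orientation (completion G) D" "potential D D0 c"
  shows "schnyder_orientation G D"
proof -
  obtain l :: "'a \<Rightarrow> 3" where l: "\<And>d. l (face_next G d) = l d + of_bool (DE d \<notin> D0)"
    "\<And>d. l d = l (prev d) + of_bool (PE d \<notin> D0)"
    using D0 unfolding schnyder_orientation_iff by blast
  \<comment> \<open>Passing from \<open>D0\<close> to \<open>D\<close> lowers the label step across
    \<open>x\<close> by \<open>orient_diff\<close>, which is minus the clockwise step of
    \<open>c\<close>. Adding \<open>c\<close> modulo 3 to the labels makes up for this.\<close>
  have flip: "of_bool (x \<notin> D) = (of_bool (x \<notin> D0) - of_int (orient_diff D D0 x) :: 3)" for x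
    by (simp add: orient_diff_def)
  have DE: "orient_diff D D0 (DE d) = c d - c (face_next G d)"
    and PE: "orient_diff D D0 (PE d) = c (prev d) - c d" for d
    using D unfolding potential_def by blast+
  have "l (face_next G d) + of_int (c (face_next G d)) = l d + of_int (c d) + of_bool (DE d \<notin> D)" for d
    unfolding flip DE l(1) by simp
  moreover have "l d + of_int (c d) = l (prev d) + of_int (c (prev d)) + of_bool (PE d \<notin> D)" for d
    unfolding flip PE by (subst l(2)) simp
  ultimately show ?thesis
    unfolding schnyder_orientation_iff using D(1) 
    by (intro conjI exI[of _ "\<lambda>d. l d + of_int (c d)"] allI)
qed


section \<open>Outdegrees and types\<close>

lemma sum_orient_diff: "sum (orient_diff D D') A = int (card (D \<inter> A)) - int (card (D' \<inter> A))"
  unfolding orient_diff_def by (simp add: sum_subtractf Int_commute)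

lemma outdegree_eq_iff:
  "(\<forall>v\<in>vertices (completion G). outdegree D v = outdegree D' v) \<longleftrightarrow>
    (\<forall>d. (\<Sum>e\<in>orbit (rot G) d. orient_diff D D' (PV e)) = 0) \<and>
    (\<forall>d. (\<Sum>e\<in>orbit (face_next G) d. orient_diff D D' (DV e)) = 0) \<and>
    (\<forall>d. orient_diff D D' (PE d) + orient_diff D D' (DE (opp G d)) +
      orient_diff D D' (PE (opp G d)) + orient_diff D D' (DE d) = 0)"
proof -
  have *: "outdegree D v = outdegree D' v \<longleftrightarrow> sum (orient_diff D D') v = 0" for v
    by (simp add: sum_orient_diff outdegree_def)
  have PV: "sum (orient_diff D D') (PV ` A) = (\<Sum>e\<in>A. orient_diff D D' (PV e))" for A
    by (simp add: sum.reindex inj_on_def)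
  have DV: "sum (orient_diff D D') (DV ` A) = (\<Sum>e\<in>A. orient_diff D D' (DV e))" for A
    by (simp add: sum.reindex inj_on_def)
  have "d \<noteq> opp G d" for d
    using opp_neq[of d] by metis
  then have E: "sum (orient_diff D D') {PE d, DE (opp G d), PE (opp G d), DE d} =
      orient_diff D D' (PE d) + orient_diff D D' (DE (opp G d)) +
      orient_diff D D' (PE (opp G d)) + orient_diff D D' (DE d)" for d
    by simp
  show ?thesis
    unfolding vertices_completion * ball_Un ball_simps(9) PV DV E by blast
qed

text \<open>The change of \<open>p\<close> across the edge of \<open>d\<close> that remains once \<open>p\<close> accounts for all crossings
  of primal half-edges; it vanishes exactly when \<open>p\<close> accounts for the dual half-edges too.\<close>

definition flux :: "('a hat_dart \<Rightarrow> int) \<Rightarrow> ('a \<Rightarrow> int) \<Rightarrow> 'a \<Rightarrow> int" where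
  "flux f p d = f (DV d) + p d - p (face_next G d)"

text \<open>Adding the two fluxes and replacing the steps of \<open>p\<close> by values on primal
  half-edges leaves the total over the four darts entering the edge-vertex, which is 0.\<close>

lemma flux_opp:
  assumes D: "orientation (completion G) D" "orientation (completion G) D'"
    and edge: "\<And>d. orient_diff D D' (PE d) + orient_diff D D' (DE (opp G d)) +
      orient_diff D D' (PE (opp G d)) + orient_diff D D' (DE d) = 0"
    and p: "\<And>a. p (rot G a) = p a + orient_diff D D' (PV (rot G a))"
  shows "flux (orient_diff D D') p (opp G d) = - flux (orient_diff D D') p d"
  using p[of "face_next G d"] p[of "prev d"] edge[of d]
  by (simp add: flux_def orient_diff_hat_opp[OF D])

section \<open>The two sides of a subdivided cycle and the function gamma\<close>

lemma length_subdivision [simp]: "length (subdivision M c) = 2 * length c"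
  by (induction c) (simp_all add: subdivision_def)

lemma subdivision_Cons: "subdivision M (d # c) = PV d # PE (opp M d) # subdivision M c"
  by (simp add: subdivision_def)

lemma nth_subdivision:
  assumes "i < length c"
  shows "subdivision M c ! (2 * i) = PV (c ! i)" "subdivision M c ! Suc (2 * i) = PE (opp M (c ! i))"
  using assms by (induction c arbitrary: i) (auto simp: subdivision_Cons nth_Cons split: nat.split)

lemma nth_subdivision_next:
  assumes "i < length c"
  shows "subdivision M c ! (2 * Suc i mod (2 * length c)) = PV (c ! (Suc i mod length c))"
proof -
  have "0 < length c" using assms by linarith
  then have "Suc i mod length c < length c" by (rule mod_less_divisor)
  then show ?thesis
    by (simp only: mod_mult_mult1 nth_subdivision(1))
qed

text \<open>Separates the turns of a subdivided cycle at edge-vertices (even positions) from those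
  at primal vertices (odd positions).\<close>

lemma UN_less_double: "(\<Union>i<2 * n. A i) = (\<Union>i<n. A (2 * i)) \<union> (\<Union>i<n. A (Suc (2 * i)))"
proof (intro equalityI subsetI)
  fix x assume "x \<in> (\<Union>i<2 * n. A i)"
  then obtain i where i: "i < 2 * n" "x \<in> A i" by blast
  then show "x \<in> (\<Union>i<n. A (2 * i)) \<union> (\<Union>i<n. A (Suc (2 * i)))"
    by (cases "even i") (auto elim!: evenE oddE)
qed auto

lemma darts_between_PV: "darts_between (completion G) (PV a) (PV b) = PV ` darts_between G a b"
proof -
  have "(hat_rot G ^^ k) (PV a) = PV ((rot G ^^ k) a)" for k
    by (induction k) simp_all
  then show ?thesis
    unfolding darts_between_def completion_simps by auto
qed

lemma darts_between_PE: "darts_between (completion G) (PE d) (PE (opp G d)) = {DE (opp G d)}"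
proof (intro equalityI subsetI)
  fix x assume "x \<in> darts_between (completion G) (PE d) (PE (opp G d))"
  then obtain k where k: "x = (hat_rot G ^^ k) (PE d)" "0 < k"
    "\<And>j. 0 < j \<Longrightarrow> j \<le> k \<Longrightarrow> (hat_rot G ^^ j) (PE d) \<noteq> PE (opp G d)"
    by (auto simp: darts_between_def)
  \<comment> \<open>Two turns around the edge-vertex already reach
    \<open>PE (opp G d)\<close>.\<close>
  have "k < 2"
    using k(3)[of 2] by (cases "k < 2") (simp_all add: numeral_2_eq_2)
  with k(1,2) show "x \<in> {DE (opp G d)}"
    by (auto simp: less_2_cases_iff)
qed (auto simp: darts_between_def intro!: exI[of _ 1] simp: le_Suc_eq)

lemma right_darts_subdivision:
  "right_darts (completion G) (subdivision G c) = (\<Union>i<length c. {DE (opp G (c ! i))}) \<union>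
    (\<Union>i<length c. PV ` darts_between G (opp G (c ! i)) (c ! (Suc i mod length c)))"
  unfolding right_darts_def length_subdivision UN_less_double
  by (intro arg_cong2[of _ _ _ _ "(\<union>)"] SUP_cong refl)
      (simp_all add: nth_subdivision nth_subdivision_next[simplified] darts_between_PE darts_between_PV)

lemma left_darts_subdivision:
  "left_darts (completion G) (subdivision G c) = (\<Union>i<length c. {DE (c ! i)}) \<union>
    (\<Union>i<length c. PV ` darts_between G (c ! (Suc i mod length c)) (opp G (c ! i)))"
proof -
  have "darts_between (completion G) (PE (opp G d)) (PE d) = {DE d}" for d
    using darts_between_PE[of "opp G d"] by simp
  then show ?thesis
    unfolding left_darts_def length_subdivision UN_less_double
    by (intro arg_cong2[of _ _ _ _ "(\<union>)"] SUP_cong refl)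
      (simp_all add: nth_subdivision nth_subdivision_next[simplified] darts_between_PV)
qed

text \<open>Covers both sides of a cycle: exchanging the roles of \<open>s\<close> and
  \<open>t\<close> exchanges left and right. Injectivity of \<open>s\<close> on vertices keeps the
  sectors disjoint, and in each sector the sum telescopes.\<close>

lemma sum_side:
  fixes n :: nat and f :: "'a hat_dart \<Rightarrow> int"
  assumes e: "inj_on e {..<n}" and s: "inj_on (\<lambda>i. orbit (rot G) (s i)) {..<n}"
    and t: "\<And>i. i < n \<Longrightarrow> t i \<in> orbit (rot G) (s i)"
    and p: "\<And>a. p (rot G a) = p a + f (PV (rot G a))"
  shows "sum f ((\<Union>i<n. {DE (e i)}) \<union> (\<Union>i<n. PV ` darts_between G (s i) (t i))) =
    (\<Sum>i<n. f (DE (e i))) + (\<Sum>i<n. p (prev (t i)) - p (s i))"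
proof -
  have sub: "darts_between G a b \<subseteq> orbit (rot G) a" for a b
    unfolding darts_between_def orbit_altdef by auto
  have orbit_eq: "orbit (rot G) a = orbit (rot G) b" if "x \<in> orbit (rot G) a" "x \<in> orbit (rot G) b" for x a b
    using that cyclic_on_orbit'[OF permutation_bij[OF bij_rot]] orbit_cyclic_eq3 by metis
  have disj: "PV ` darts_between G (s i) (t i) \<inter> PV ` darts_between G (s j) (t j) = {}"
    if "i < n" "j < n" "i \<noteq> j" for i j
  proof -
    have "orbit (rot G) (s i) \<noteq> orbit (rot G) (s j)"
      using s that by (auto simp: inj_on_def)
    then show ?thesis
      using sub orbit_eq by blast
  qed
  have "sum f ((\<Union>i<n. {DE (e i)}) \<union> (\<Union>i<n. PV ` darts_between G (s i) (t i))) =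
      sum f (\<Union>i<n. {DE (e i)}) + sum f (\<Union>i<n. PV ` darts_between G (s i) (t i))"
    by (rule sum.union_disjoint) auto
  also have "sum f (\<Union>i<n. {DE (e i)}) = (\<Sum>i<n. f (DE (e i)))"
    using e by (subst sum.UNION_disjoint) (auto simp: inj_on_def)
  also have "sum f (\<Union>i<n. PV ` darts_between G (s i) (t i)) =
      (\<Sum>i<n. sum f (PV ` darts_between G (s i) (t i)))"
    using disj by (intro sum.UNION_disjoint) auto
  also have "\<dots> = (\<Sum>i<n. sum (f \<circ> PV) (darts_between G (s i) (t i)))"
    by (intro sum.cong refl sum.reindex inj_onI) simp_all
  also have "\<dots> = (\<Sum>i<n. p (prev (t i)) - p (s i))"
  proof (rule sum.cong[OF HOL.refl])
    fix i assume "i \<in> {..<n}"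
    then show "sum (f \<circ> PV) (darts_between G (s i) (t i)) = p (prev (t i)) - p (s i)"
      using t by (intro sum_darts_between[where p = p]) (simp_all add: p bij_rot bij_is_inj)
  qed
  finally show ?thesis .
qed

lemma bij_betw_Suc_mod: "bij_betw (\<lambda>i. Suc i mod n) {..<n} {..<n}"
proof -
  have "inj_on (\<lambda>i. Suc i mod n) {..<n}"
    by (rule inj_onI) (auto simp: mod_Suc split: if_splits)
  then show ?thesis
    unfolding bij_betw_def by (intro conjI endo_inj_surj) auto
qed

text \<open>Once the terms at vertices are regrouped by edges, each edge of the cycle contributes
  its flux on the right and the negative of its flux on the left, hence the factor 2.\<close>

lemma gamma_diff:
  assumes D: "orientation (completion G) D" "orientation (completion G) D'"
    and edge: "\<And>d. orient_diff D D' (PE d) + orient_diff D D' (DE (opp G d)) +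
      orient_diff D D' (PE (opp G d)) + orient_diff D D' (DE d) = 0"
    and p: "\<And>a. p (rot G a) = p a + orient_diff D D' (PV (rot G a))"
    and c: "cycle G c"
  shows "gamma G D c - gamma G D' c = 2 * sum_list (map (flux (orient_diff D D') p) c)"
proof -
  let ?f = "orient_diff D D'" and ?n = "length c"
  let ?next = "\<lambda>i. c ! (Suc i mod ?n)"
  have "c \<noteq> []" and walk: "walk G c" and closed: "head G (last c) = tail G (hd c)"
    and dist: "distinct (map (tail G) c)"
    using c by (auto simp: cycle_def closed_walk_def)
  have step: "tail G (opp G (c ! i)) = tail G (?next i)" if "i < ?n" for i
  proof (cases "Suc i < ?n")
    case True
    then show ?thesis
      using walk unfolding walk_def successively_conv_nth head_def by simp
  next
    case False
    then have "Suc i = ?n" using that by simp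
    then show ?thesis
      using closed \<open>c \<noteq> []\<close> by (metis diff_Suc_1 hd_conv_nth head_def last_conv_nth mod_self)
  qed
  \<comment> \<open>Cyclic reindexing moves the terms belonging to the outgoing dart of a turn to
    the summand of that dart.\<close>
  have shift: "(\<Sum>i<?n. u (?next i)) = (\<Sum>i<?n. u (c ! i))" for u :: "'a \<Rightarrow> int"
    using sum.reindex_bij_betw[OF bij_betw_Suc_mod, of "\<lambda>i. u (c ! i)" ?n] .
  have inj_tail: "inj_on (\<lambda>i. tail G (c ! i)) {..<?n}"
    using dist by (auto simp: inj_on_def distinct_conv_nth)
  then have inj_c: "inj_on (\<lambda>i. c ! i) {..<?n}"
    by (auto simp: inj_on_def)
  have inj_next: "inj_on (\<lambda>i. tail G (?next i)) {..<?n}"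
    using comp_inj_on[of "\<lambda>i. Suc i mod ?n" "{..<?n}" "\<lambda>i. tail G (c ! i)"] inj_tail
      bij_betw_Suc_mod[of ?n] by (simp add: bij_betw_def comp_def)
  have mem: "d \<in> tail G d" for d
    by (simp add: tail_def)
  have "sum ?f (right_darts (completion G) (subdivision G c)) =
      (\<Sum>i<?n. ?f (DE (opp G (c ! i)))) + (\<Sum>i<?n. p (prev (?next i)) - p (opp G (c ! i)))"
    unfolding right_darts_subdivision
  proof (rule sum_side[OF _ _ _ p])
    show "inj_on (\<lambda>i. opp G (c ! i)) {..<?n}"
      using inj_c by (simp add: inj_on_def)
    show "inj_on (\<lambda>i. orbit (rot G) (opp G (c ! i))) {..<?n}"
      using inj_next by (simp add: inj_on_def step flip: tail_def)
    show "?next i \<in> orbit (rot G) (opp G (c ! i))" if "i < ?n" for i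
      using mem[of "?next i"] step[OF that] unfolding tail_def by metis
  qed
  \<comment> \<open>After the shift, \<open>p (prev d)\<close> is the value of \<open>p\<close> at
    \<open>face_next G (opp G d)\<close>, so the terms of \<open>d\<close> form a flux of
    \<open>opp G d\<close>.\<close>
  also have "\<dots> = (\<Sum>i<?n. - flux ?f p (opp G (c ! i)))"
    by (simp add: sum_subtractf shift[of "\<lambda>d. p (prev d)"] flux_def orient_diff_hat_opp[OF D]
        sum.distrib sum_negf)
  also have "\<dots> = (\<Sum>i<?n. flux ?f p (c ! i))"
    by (simp add: flux_opp[OF D edge p])
  finally have right: "sum ?f (right_darts (completion G) (subdivision G c)) = \<dots>" .
  have "sum ?f (left_darts (completion G) (subdivision G c)) =
      (\<Sum>i<?n. ?f (DE (c ! i))) + (\<Sum>i<?n. p (prev (opp G (c ! i))) - p (?next i))"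
    unfolding left_darts_subdivision
  proof (rule sum_side[OF inj_c _ _ p])
    show "inj_on (\<lambda>i. orbit (rot G) (?next i)) {..<?n}"
      using inj_next by (simp add: tail_def)
    show "opp G (c ! i) \<in> orbit (rot G) (?next i)" if "i < ?n" for i
      using mem[of "opp G (c ! i)"] step[OF that] unfolding tail_def by metis
  qed
  also have "\<dots> = - (\<Sum>i<?n. flux ?f p (c ! i))"
    by (simp add: sum_subtractf shift flux_def orient_diff_hat_opp[OF D] sum.distrib sum_negf)
  finally have left: "sum ?f (left_darts (completion G) (subdivision G c)) = \<dots>" .
  have "gamma G D c - gamma G D' c = 2 * (\<Sum>i<?n. flux ?f p (c ! i))"
    using left right unfolding gamma_def sum_orient_diff by simp
  also have "(\<Sum>i<?n. flux ?f p (c ! i)) = sum_list (map (flux ?f p) c)"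
    by (simp add: sum_list_sum_nth lessThan_atLeast0)
  finally show ?thesis .
qed


section \<open>Closed cochains on the map\<close>

text \<open>As \<open>R\<close> has one dart of each edge and \<open>z\<close> changes sign under
  reversal, the terms with \<open>u (opp G d)\<close> supply the darts outside \<open>R\<close>. The
  pairing of a cochain with a flow can thus be computed over all darts.\<close>

lemma sum_antisymmetric_pairing:
  fixes z u :: "'a \<Rightarrow> int"
  assumes R: "orientation G R" and z: "\<And>d. z (opp G d) = - z d"
  shows "(\<Sum>d\<in>R. z d * (u d - u (opp G d))) = (\<Sum>d\<in>UNIV. z d * u d)"
proof -
  have mem: "opp G d \<in> R \<longleftrightarrow> d \<notin> R" for d
    using R unfolding orientation_def by blast
  have "bij_betw (opp G) R (- R)"
    by (rule bij_betw_byWitness[of _ "opp G"]) (auto simp: mem)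
  then have "(\<Sum>d\<in>- R. z d * u d) = (\<Sum>d\<in>R. z (opp G d) * u (opp G d))"
    using sum.reindex_bij_betw[of "opp G" R "- R" "\<lambda>d. z d * u d"] by simp
  then have "(\<Sum>d\<in>R. z d * (u d - u (opp G d))) = (\<Sum>d\<in>R. z d * u d) + (\<Sum>d\<in>- R. z d * u d)"
    by (simp add: z right_diff_distrib sum_subtractf sum_negf)
  also have "\<dots> = (\<Sum>d\<in>UNIV. z d * u d)"
    by (subst sum.union_disjoint[symmetric]) auto
  finally show ?thesis .
qed

lemma sum_walk_flow:
  fixes z :: "'a \<Rightarrow> int"
  assumes R: "orientation G R" and z: "\<And>d. z (opp G d) = - z d"
  shows "(\<Sum>d\<in>R. z d * walk_flow G R w d) = sum_list (map z w)"
proof -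
  have "(\<Sum>d\<in>R. z d * walk_flow G R w d) =
      (\<Sum>d\<in>R. z d * (int (count_list w d) - int (count_list w (opp G d))))"
    by (simp add: walk_flow_def)
  also have "\<dots> = (\<Sum>d\<in>UNIV. z d * int (count_list w d))"
    by (rule sum_antisymmetric_pairing[where z = z, OF R z])
  also have "\<dots> = sum_list (map z w)"
  proof (induction w)
    case (Cons a w)
    have "(\<Sum>d\<in>UNIV. z d * int (count_list (a # w) d)) =
        (\<Sum>d\<in>UNIV. (if d = a then z d else 0) + z d * int (count_list w d))"
      by (intro sum.cong) (auto simp: distrib_left)
    then show ?case
      using Cons.IH by (simp add: sum.distrib)
  qed simp
  finally show ?thesis .
qed

text \<open>Discrete Stokes theorem: a cochain with zero sum around every face pairs to 0 with every
  combination of facial flows.\<close>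

lemma sum_zero_homologous:
  fixes z :: "'a \<Rightarrow> int"
  assumes R: "orientation G R" and z: "\<And>d. z (opp G d) = - z d"
    and faces: "\<And>F. F \<in> faces G \<Longrightarrow> sum z F = 0" and f: "zero_homologous G R f"
  shows "(\<Sum>d\<in>R. z d * f d) = 0"
proof -
  obtain c where c: "\<And>d. f d = (\<Sum>F\<in>faces G. c F * subgraph_flow G R F d)"
    using f unfolding zero_homologous_def by blast
  have F: "(\<Sum>d\<in>R. z d * subgraph_flow G R F d) = sum z F" for F
  proof -
    have "(\<Sum>d\<in>R. z d * subgraph_flow G R F d) = (\<Sum>d\<in>R. z d * (of_bool (d \<in> F) - of_bool (opp G d \<in> F)))"
      by (simp add: subgraph_flow_def)
    also have "\<dots> = (\<Sum>d\<in>UNIV. z d * of_bool (d \<in> F))"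
      by (rule sum_antisymmetric_pairing[where z = z, OF R z])
    finally show ?thesis by simp
  qed
  have "(\<Sum>d\<in>R. z d * f d) = (\<Sum>F\<in>faces G. \<Sum>d\<in>R. c F * (z d * subgraph_flow G R F d))"
    unfolding c sum_distrib_left by (subst sum.swap) (simp add: mult.left_commute)
  also have "\<dots> = 0"
    by (simp add: F faces flip: sum_distrib_left)
  finally show ?thesis .
qed

text \<open>Up to a zero-homologous flow, \<open>w\<close> is an integer combination of the basis
  cycles, and the pairing with \<open>z\<close> vanishes on both parts.\<close>

lemma closed_walk_sum_eq_0:
  fixes z :: "'a \<Rightarrow> int"
  assumes R: "orientation G R" and z: "\<And>d. z (opp G d) = - z d"
    and faces: "\<And>F. F \<in> faces G \<Longrightarrow> sum z F = 0"
    and B: "homology_basis G R g B" and B0: "\<And>c. c \<in> set B \<Longrightarrow> sum_list (map z c) = 0"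
    and w: "closed_walk G w"
  shows "sum_list (map z w) = 0"
proof -
  obtain m where m: "zero_homologous G R
      (\<lambda>d. walk_flow G R w d - (\<Sum>i<2 * g. m i * walk_flow G R (B ! i) d))"
    using B w unfolding homology_basis_def by blast
  have len: "length B = 2 * g"
    using B unfolding homology_basis_def by blast
  have "0 = (\<Sum>d\<in>R. z d * (walk_flow G R w d - (\<Sum>i<2 * g. m i * walk_flow G R (B ! i) d)))"
    using sum_zero_homologous[where z = z, OF R z faces m] by simp
  also have "\<dots> = sum_list (map z w) - (\<Sum>d\<in>R. \<Sum>i<2 * g. m i * (z d * walk_flow G R (B ! i) d))"
    by (simp add: right_diff_distrib sum_subtractf sum_walk_flow[where z = z, OF R z] sum_distrib_left mult.left_commute)
  also have "(\<Sum>d\<in>R. \<Sum>i<2 * g. m i * (z d * walk_flow G R (B ! i) d)) =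
      (\<Sum>i<2 * g. m i * sum_list (map z (B ! i)))"
    by (subst sum.swap) (simp add: sum_walk_flow[where z = z, OF R z] flip: sum_distrib_left)
  also have "\<dots> = 0"
    by (rule sum.neutral) (simp add: B0 len)
  finally show ?thesis by simp
qed

text \<open>Recording the end points lets the empty list join each \<open>u\<close> to itself, so
  that concatenation composes walks.\<close>

fun walk_betw :: "'a set \<Rightarrow> 'a list \<Rightarrow> 'a set \<Rightarrow> bool" where
  "walk_betw u [] v \<longleftrightarrow> u = v"
| "walk_betw u (d # w) v \<longleftrightarrow> tail G d = u \<and> walk_betw (head G d) w v"

lemma walk_betw_append: "walk_betw u (w @ w') v \<longleftrightarrow> (\<exists>x. walk_betw u w x \<and> walk_betw x w' v)"
  by (induction w arbitrary: u) auto

lemma walk_betw_rev: "walk_betw u w v \<Longrightarrow> walk_betw v (rev (map (opp G) w)) u"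
  by (induction w arbitrary: u) (auto simp: walk_betw_append head_def)

lemma walk_betw_imp_walk:
  assumes "walk_betw u w v" "w \<noteq> []"
  shows "walk G w \<and> tail G (hd w) = u \<and> head G (last w) = v"
  using assms
proof (induction w arbitrary: u)
  case (Cons d w)
  then show ?case
    by (cases w) (auto simp: walk_def)
qed simp

lemma vertex_potential:
  fixes z :: "'a \<Rightarrow> int"
  assumes closed: "\<And>w. closed_walk G w \<Longrightarrow> sum_list (map z w) = 0"
  shows "\<exists>q. \<forall>d. q (head G d) = q (tail G d) + z d"
proof -
  define P where "P u s v \<longleftrightarrow> (\<exists>w. walk_betw u w v \<and> s = sum_list (map z w))" for u s v
  have "\<exists>q. \<forall>u s v. P u s v \<longrightarrow> q v = q u + s"
  proof (rule potential_exists)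
    show "P u 0 u" for u
      unfolding P_def by (rule exI[of _ "[]"]) simp
    show "P u (s + t) x" if "P u s v" "P v t x" for u v x s t
      using that unfolding P_def by (metis map_append sum_list_append walk_betw_append)
    show "\<exists>t. P v t u" if "P u s v" for u v s
      using that walk_betw_rev unfolding P_def by blast
    show "s = 0" if loop: "P u s u" for u s
    proof -
      obtain w where w: "walk_betw u w u" "s = sum_list (map z w)"
        using loop unfolding P_def by blast
      show ?thesis
      proof (cases "w = []")
        case False
        then have "closed_walk G w"
          using walk_betw_imp_walk[OF w(1)] unfolding closed_walk_def by simp
        then show ?thesis using closed w(2) by simp
      qed (simp add: w)
    qed
  qed
  then obtain q where "\<And>u s v. P u s v \<Longrightarrow> q v = q u + s" by blast
  moreover have "P (tail G d) (z d) (head G d)" for d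
    unfolding P_def by (rule exI[of _ "[d]"]) simp
  ultimately show ?thesis by blast
qed


section \<open>The class of a Schnyder orientation\<close>

text \<open>Around each vertex of the completion the difference is the sequence of steps of
  \<open>c\<close> along a closed rotation, so its sum is 0.\<close>

lemma potential_imp_same_outdegrees:
  assumes D: "orientation (completion G) D" "orientation (completion G) D'" and c: "potential D D' c"
  shows "\<forall>v\<in>vertices (completion G). outdegree D v = outdegree D' v"
proof -
  have "(\<Sum>e\<in>orbit (rot G) d. orient_diff D D' (PV e)) = 0" for d
  proof -
    have "(\<Sum>e\<in>orbit (rot G) d. orient_diff D D' (PV e)) = (\<Sum>e\<in>orbit (rot G) d. orient_diff D D' (PV (rot G e)))"
      by (rule sum_orbit_shift[OF bij_rot, symmetric])
    also have "\<dots> = (\<Sum>e\<in>orbit (rot G) d. c (rot G e) - c e)"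
      using c by (simp add: potential_def orient_diff_hat_opp[OF D])
    finally show ?thesis
      by (simp add: sum_subtractf sum_orbit_shift[OF bij_rot])
  qed
  moreover have "(\<Sum>e\<in>orbit (face_next G) d. orient_diff D D' (DV e)) = 0" for d
    using c by (simp add: potential_def orient_diff_hat_opp[OF D] sum_subtractf sum_orbit_shift[OF bij_face_next])
  moreover have "orient_diff D D' (PE d) + orient_diff D D' (DE (opp G d)) +
      orient_diff D D' (PE (opp G d)) + orient_diff D D' (DE d) = 0" for d
    using c by (simp add: potential_def)
  ultimately show ?thesis
    unfolding outdegree_eq_iff by blast
qed

lemma schnyder_class_iff:
  assumes R: "orientation G R" and B: "homology_basis G R g B" and D0: "schnyder_orientation G D0"
  shows "D \<in> schnyder_class G B D0 \<longleftrightarrow> orientation (completion G) D \<and> (\<exists>c. potential D D0 c)"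
proof
  have oD0: "orientation (completion G) D0"
    using D0 by (simp add: schnyder_orientation_def)
  have cycles: "cycle G c" if "c \<in> set B" for c
    using B that by (auto simp: homology_basis_def)
  {
    assume "D \<in> schnyder_class G B D0"
    then have D: "orientation (completion G) D"
      and out: "\<forall>v\<in>vertices (completion G). outdegree D v = outdegree D0 v"
      and type: "map (gamma G D) B = map (gamma G D0) B"
      by (auto simp: schnyder_class_def schnyder_orientation_def orientation_type_def)
    let ?f = "orient_diff D D0"
    note out = out[unfolded outdegree_eq_iff]
    have edge: "\<And>d. ?f (PE d) + ?f (DE (opp G d)) + ?f (PE (opp G d)) + ?f (DE d) = 0"
      using out by blast
    \<comment> \<open>Going from angle \<open>a\<close> to angle \<open>rot G a\<close> crosses the
      half-edge of \<open>rot G a\<close>, hence the shifted argument.\<close>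
    have "(\<Sum>e\<in>orbit (rot G) d. ?f (PV (rot G e))) = 0" for d
      using out sum_orbit_shift[OF bij_rot, of "\<lambda>e. ?f (PV e)" d] by simp
    from orbit_potential[OF bij_rot this]
    obtain p where p: "\<And>a. p (rot G a) = p a + ?f (PV (rot G a))" by blast
    let ?z = "flux ?f p"
    have "\<exists>q. \<forall>d. q (head G d) = q (tail G d) + ?z d"
    proof (rule vertex_potential, rule closed_walk_sum_eq_0[OF R _ _ B])
      show "?z (opp G d) = - ?z d" for d
        by (rule flux_opp[OF D oD0 edge p])
      \<comment> \<open>Closedness is the outdegree condition at the dual vertex; the terms in
        \<open>p\<close> cancel because \<open>face_next\<close> permutes the darts of
        \<open>F\<close>.\<close>
      show "sum ?z F = 0" if "F \<in> faces G" for F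
        using that out unfolding faces_def flux_def
        by (auto simp: sum.distrib sum_subtractf sum_orbit_shift[OF bij_face_next])
      show "sum_list (map ?z c) = 0" if "c \<in> set B" for c
        using gamma_diff[OF D oD0 edge p cycles[OF that]] type that by simp
    qed
    then obtain q where q: "\<And>d. q (head G d) = q (tail G d) + ?z d" by blast
    have tail_rot: "tail G (rot G d) = tail G d" for d
      unfolding tail_def using permutation_orbit_step[OF permutation_bij[OF bij_rot]] .
    have tail_prev: "tail G (prev d) = tail G d" for d
      using tail_rot[of "prev d"] by simp
    have tail_face_next: "tail G (face_next G d) = head G d" for d
      using tail_rot[of "face_next G d"] by (simp add: head_def)
    \<comment> \<open>The correction \<open>q\<close> is constant around each primal vertex, so it
      keeps the steps of \<open>p\<close> there, while across the edges of the map it cancels the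
      flux.\<close>
    have "potential D D0 (\<lambda>a. p a + q (tail G a))"
      unfolding potential_def
    proof (intro conjI allI)
      fix d
      show "?f (PE d) = p (prev d) + q (tail G (prev d)) - (p d + q (tail G d))"
        using p[of "prev d"] by (simp add: tail_prev orient_diff_hat_opp[OF D oD0])
      show "?f (DE d) = p d + q (tail G d) - (p (face_next G d) + q (tail G (face_next G d)))"
        using q[of d] by (simp add: tail_face_next flux_def orient_diff_hat_opp[OF D oD0])
    qed
    with D show "orientation (completion G) D \<and> (\<exists>c. potential D D0 c)" by blast
  }
  {
    assume "orientation (completion G) D \<and> (\<exists>c. potential D D0 c)"
    then obtain c where D: "orientation (completion G) D" and c: "potential D D0 c" by blast
    let ?f = "orient_diff D D0"
    note out = potential_imp_same_outdegrees[OF D oD0 c]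
    have edge: "\<And>d. ?f (PE d) + ?f (DE (opp G d)) + ?f (PE (opp G d)) + ?f (DE d) = 0"
      using out unfolding outdegree_eq_iff by blast
    have p: "c (rot G a) = c a + ?f (PV (rot G a))" for a
      using c by (simp add: potential_def orient_diff_hat_opp[OF D oD0])
    \<comment> \<open>Here \<open>c\<close> itself takes the place of \<open>p\<close> and already
      accounts for the dual half-edges, so no flux remains and \<open>gamma\<close> does not
      change.\<close>
    have "flux ?f c = (\<lambda>d. 0)"
      using c by (simp add: fun_eq_iff potential_def flux_def orient_diff_hat_opp[OF D oD0])
    then have "gamma G D b = gamma G D0 b" if "b \<in> set B" for b
      using gamma_diff[OF D oD0 edge p cycles[OF that]] by simp
    then show "D \<in> schnyder_class G B D0"
      using out schnyder_orientation_potential[OF D0 D c]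
      by (simp add: schnyder_class_def orientation_type_def)
  }
qed

end

theorem theorem40:
  fixes G :: "'a::finite cmap" and g :: nat
    and R :: "'a set" and B :: "'a list list"
    and Rh :: "'a hat_dart set" and D0 :: "'a hat_dart set" and f0 :: "'a hat_dart set"
  assumes "surface_map G g"
    and "orientation G R"
    and "homology_basis G R g B"
    and "orientation (completion G) Rh"
    and "schnyder_orientation G D0"
    and "f0 \<in> faces (completion G)"
  shows "distributive_lattice
    \<lparr>carrier = schnyder_class G B D0, eq = (=), le = orientation_le (completion G) Rh f0\<rparr>"
proof -
  interpret cell_map G
    using assms(1) by unfold_locales (simp add: surface_map_def)
  obtain a0 where "f0 = angle_face G a0"
    using assms(6) by (auto simp: faces_completion)
  then show ?thesis
    using distributive_lattice_potential_class[OF schnyder_class_iff[OF assms(2,3,5)] assms(4)] by simp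
qed

end
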